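(* Let $p$ be a positive integer and let $\mu$ be a probability measure on the real line with $R$-transform $R_\mu$. (a) If $\mu$ admits a $p$-th moment, then $R_\mu$ admits the Taylor expansion (non-tangentially at $0$) $$R_\mu(z)=\sum_{i=0}^{p-1}k_{i+1}(\mu)z^i+o(z^{p-1}),$$ where $k_1(\mu),\dots,k_p(\mu)$ are the first $p$ free cumulants of $\mu$. (b) Conversely, if $p$ is even or if the support of $\mu$ is bounded below or bounded above, and if $R_\mu$ admits a Taylor expansion of order $p-1$ with real coefficients, then $\mu$ has a $p$-th moment.
   Context: A measure $\mu$ admits (has) a $p$-th moment if $\int_{\mathbb{R}}|t|^p\,d\mu(t)<\infty$; then $m_i(\mu)=\int t^i\,d\mu(t)$ for $0\le i\le p$. For $\alpha,\beta>0$ let $\Delta_{\alpha,\beta}=\{z=x+iy\in\mathbb{C}: |x|<-\alpha y,\ |z|<\beta\}$. Let $\mathcal{H}$ be the set of functions $f$ that are analytic in a domain $\mathcal{D}_f\subset\mathbb{C}$ such that for every $\alpha>0$ there is $\beta>0$ with $\Delta_{\alpha,\beta}\subset\mathcal{D}_f$. For $f\in\mathcal{H}$, limits at $0$ are non-tangential: $\lim_{z\to0}f(z)=l$ means that for every $\alpha>0$ there is $\beta>0$ such that $f(z)\to l$ as $z\to0$ with $z\in\Delta_{\alpha,\beta}$. The function $f\in\mathcal{H}$ admits a Taylor expansion of order $q\ge 0$, written $f(z)=\sum_{i=0}^q a_iz^i+o(z^q)$ with coefficients $a_0,\dots,a_q\in\mathbb{C}$, if $f(z)=\sum_{i=0}^q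 a_iz^i+z^q\upsilon(z)$ for some $\upsilon\in\mathcal{H}$ with $\lim_{z\to0}\upsilon(z)=0$. The $R$-transform: for a probability measure $\mu$ on $\mathbb{R}$, its Cauchy transform is $G_\mu(z)=\int_{\mathbb{R}}\frac{d\mu(t)}{z-t}$ for $z$ in the upper half-plane. It is known that for all $\alpha>0$, all $\varepsilon\in(0,\min\{\alpha,1\})$ and all small enough $\beta>0$, the map $z\mapsto G_\mu(1/z)$ is a conformal bijection from $\Delta_{\alpha,\beta}$ onto an open set $\mathcal{D}_{\alpha,\beta}$ with $\Delta_{\alpha-\varepsilon,(1-\varepsilon)\beta}\subset\mathcal{D}_{\alpha,\beta}\subset\Delta_{\alpha+\varepsilon,(1+\varepsilon)\beta}$. The inverses of these bijections define together an analytic function $L_\mu$ on the union of the sets $\mathcal{D}_{\alpha,\beta}$; one sets $K_\mu=1/L_\mu$ and $R_\mu(z)=K_\mu(z)-1/z$. Then $R_\mu\in\mathcal{H}$. Free cumulants: let $\mathrm{NC}(i)$ be the set of non-crossing partitions of $\{1,\dots,i\}$, i.e. partitions for which there are no $j_1<j_2<j_3<j_4$ with $j_1,j_3$ in one class and $j_2,j_4$ in another class. If $\mu$ has a $p$-th moment, its first $p$ free cumulants $k_1(\mu),\dots,k_p(\mu)$ are the real numbers uniquely determined by $m_i(\mu)=\sum_{\pi\in\mathrm{NC}(i)}\prod_{V\in\pi}k_{|V|}(\mu)$ for $i=1,\dots,p$, the product being over the classes $V$ of $\pi$. *)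

theory Defs
  imports "HOL-Probability.Probability" "HOL-Complex_Analysis.Complex_Analysis"
begin

section \<open>Functions near \<open>0\<close> in the lower half-plane\<close>

definition trunc_cone :: "real \<Rightarrow> real \<Rightarrow> complex set"
  where "trunc_cone \<alpha> \<beta> = {z. \<bar>Re z\<bar> < - \<alpha> * Im z \<and> cmod z < \<beta>}"

text \<open>
  A partial function is given by its domain \<open>D\<close> and a total function \<open>f\<close> whose values outside
  \<open>D\<close> are irrelevant.
\<close>

definition class_H :: "complex set \<Rightarrow> (complex \<Rightarrow> complex) \<Rightarrow> bool"
  where "class_H D f \<longleftrightarrow> open D \<and> connected D \<and> f analytic_on D \<and>
           (\<forall>\<alpha>>0. \<exists>\<beta>>0. trunc_cone \<alpha> \<beta> \<subseteq> D)"

definition nontangential_lim :: "(complex \<Rightarrow> complex) \<Rightarrow> complex \<Rightarrow> bool"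
  where "nontangential_lim f l \<longleftrightarrow>
           (\<forall>\<alpha>>0. \<exists>\<beta>>0. (f \<longlongrightarrow> l) (at 0 within trunc_cone \<alpha> \<beta>))"

text \<open>The identity of partial functions is required on the common domain of \<open>f\<close> and the remainder.\<close>

definition has_taylor_expansion ::
    "complex set \<Rightarrow> (complex \<Rightarrow> complex) \<Rightarrow> nat \<Rightarrow> (nat \<Rightarrow> complex) \<Rightarrow> bool"
  where "has_taylor_expansion D f q a \<longleftrightarrow> class_H D f \<and>
           (\<exists>E \<upsilon>. class_H E \<upsilon> \<and> nontangential_lim \<upsilon> 0 \<and>
              (\<forall>z\<in>D \<inter> E. f z = (\<Sum>i\<le>q. a i * z ^ i) + z ^ q * \<upsilon> z))"


section \<open>The R-transform\<close>

text \<open>Only used for \<open>z\<close> in the upper half-plane.\<close>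

definition cauchy_transform :: "real measure \<Rightarrow> complex \<Rightarrow> complex"
  where "cauchy_transform \<mu> z = (LINT t|\<mu>. 1 / (z - complex_of_real t))"

text \<open>
  \<open>is_R_transform \<mu> D R\<close>: the function \<open>R\<close> with domain \<open>D\<close> is an R-transform of \<open>\<mu>\<close>. The set \<open>A\<close>
  collects the admissible pairs \<open>(\<alpha>, \<beta>)\<close>; it contains \<open>(\<alpha>, \<beta>)\<close> for every \<open>\<alpha> > 0\<close> and all
  sufficiently small \<open>\<beta> > 0\<close>. The function \<open>L\<close> is a common inverse of the maps
  \<open>z \<mapsto> cauchy_transform \<mu> (1 / z)\<close> on the cones \<open>trunc_cone \<alpha> \<beta>\<close> with \<open>(\<alpha>, \<beta>) \<in> A\<close> (so these maps
  are injective), and \<open>D\<close> is the union of the images of these cones. How small \<open>\<beta>\<close> has to be is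
  not canonical, so \<open>R\<close> is determined by \<open>\<mu>\<close> only up to the choice of its domain; this is why we use
  a predicate. Lemma \<open>R_transform_exists\<close> below shows that it can always be satisfied.
\<close>

definition is_R_transform :: "real measure \<Rightarrow> complex set \<Rightarrow> (complex \<Rightarrow> complex) \<Rightarrow> bool"
  where "is_R_transform \<mu> D R \<longleftrightarrow>
    (\<exists>A L.
       (\<forall>(\<alpha>, \<beta>)\<in>A. \<alpha> > 0 \<and> \<beta> > 0) \<and>
       (\<forall>\<alpha>>0. \<forall>\<^sub>F \<beta> in at_right 0. (\<alpha>, \<beta>) \<in> A) \<and>
       (\<forall>(\<alpha>, \<beta>)\<in>A. \<forall>z\<in>trunc_cone \<alpha> \<beta>. L (cauchy_transform \<mu> (1 / z)) = z) \<and>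
       D = (\<Union>(\<alpha>, \<beta>)\<in>A. (\<lambda>z. cauchy_transform \<mu> (1 / z)) ` trunc_cone \<alpha> \<beta>) \<and>
       (\<forall>w\<in>D. R w = 1 / L w - 1 / w))"


section \<open>Moments and free cumulants\<close>

definition has_moment :: "real measure \<Rightarrow> nat \<Rightarrow> bool"
  where "has_moment \<mu> p \<longleftrightarrow> integrable \<mu> (\<lambda>t. \<bar>t\<bar> ^ p)"

definition moment :: "real measure \<Rightarrow> nat \<Rightarrow> real"
  where "moment \<mu> i = (LINT t|\<mu>. t ^ i)"

definition noncrossing_partitions :: "nat \<Rightarrow> nat set set set"
  where "noncrossing_partitions n = {\<pi>. partition_on {1..n} \<pi> \<and>
           \<not> (\<exists>j1 j2 j3 j4. \<exists>V\<in>\<pi>. \<exists>W\<in>\<pi>. V \<noteq> W \<and> j1 < j2 \<and> j2 < j3 \<and> j3 < j4 \<and>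
                 j1 \<in> V \<and> j3 \<in> V \<and> j2 \<in> W \<and> j4 \<in> W)}"

text \<open>
  The first \<open>n\<close> moment-cumulant equations determine the first \<open>n\<close> cumulants, so \<open>k\<^sub>n\<close> does not
  depend on how many further equations are imposed; see \<open>free_cumulant_iff\<close> below.
\<close>

definition moment_cumulant_eqs :: "real measure \<Rightarrow> nat \<Rightarrow> (nat \<Rightarrow> real) \<Rightarrow> bool"
  where "moment_cumulant_eqs \<mu> n k \<longleftrightarrow>
           (\<forall>i\<in>{1..n}. moment \<mu> i = (\<Sum>\<pi>\<in>noncrossing_partitions i. \<Prod>V\<in>\<pi>. k (card V)))"

definition free_cumulant :: "real measure \<Rightarrow> nat \<Rightarrow> real"
  where "free_cumulant \<mu> n = (THE x. \<exists>k. moment_cumulant_eqs \<mu> n k \<and> k n = x)"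

definition measure_support :: "'a::topological_space measure \<Rightarrow> 'a set"
  where "measure_support \<mu> = {x. \<forall>U. open U \<longrightarrow> x \<in> U \<longrightarrow> emeasure \<mu> U > 0}"


section \<open>The free cumulants are well-defined\<close>

lemma finite_noncrossing_partitions: "finite (noncrossing_partitions n)"
  by (rule finite_subset[OF _ finitely_many_partition_on[of "{1..n}"]])
     (auto simp: noncrossing_partitions_def)

lemma full_block_noncrossing:
  assumes "n \<ge> 1"
  shows "{{1..n}} \<in> noncrossing_partitions n"
  using assms by (auto simp: noncrossing_partitions_def partition_on_def disjoint_def)

lemma noncrossing_block_card:
  assumes "\<pi> \<in> noncrossing_partitions n" "V \<in> \<pi>"
  shows "1 \<le> card V" "card V \<le> n"
    and "\<pi> \<noteq> {{1..n}} \<Longrightarrow> card V < n"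
proof -
  have part: "partition_on {1..n} \<pi>"
    using assms(1) by (simp add: noncrossing_partitions_def)
  have sub: "V \<subseteq> {1..n}" and ne: "V \<noteq> {}"
    using part assms(2) by (auto simp: partition_on_def)
  have fin: "finite V"
    using sub finite_subset by blast
  show "1 \<le> card V"
    using fin ne by (simp add: Suc_le_eq card_gt_0_iff)
  show le: "card V \<le> n"
    using card_mono[OF _ sub] by simp
  assume neq: "\<pi> \<noteq> {{1..n}}"
  show "card V < n"
  proof (rule ccontr)
    assume "\<not> card V < n"
    hence V: "V = {1..n}"
      using le sub by (intro card_subset_eq) auto
    have "W = V" if "W \<in> \<pi>" for W
    proof (rule ccontr)
      assume "W \<noteq> V"
      hence "W \<inter> V = {}"
        using part that assms(2) by (auto simp: partition_on_def disjoint_def)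
      moreover have "W \<subseteq> V" "W \<noteq> {}"
        using part that V by (auto simp: partition_on_def)
      ultimately show False by blast
    qed
    hence "\<pi> = {{1..n}}" using V assms(2) by blast
    thus False using neq by blast
  qed
qed

lemma noncrossing_sum_split:
  assumes "n \<ge> 1"
  shows "(\<Sum>\<pi>\<in>noncrossing_partitions n. \<Prod>V\<in>\<pi>. k (card V)) =
           k n + (\<Sum>\<pi>\<in>noncrossing_partitions n - {{{1..n}}}. \<Prod>V\<in>\<pi>. (k (card V) :: real))"
  by (subst sum.remove[OF finite_noncrossing_partitions full_block_noncrossing[OF assms]]) simp

lemma moment_cumulant_eqs_exists: "\<exists>k. moment_cumulant_eqs \<mu> n k"
proof (induction n)
  case 0
  thus ?case by (simp add: moment_cumulant_eqs_def)
next
  case (Suc n)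
  then obtain k where k: "moment_cumulant_eqs \<mu> n k" by blast
  define r where "r = (\<Sum>\<pi>\<in>noncrossing_partitions (Suc n) - {{{1..Suc n}}}. \<Prod>V\<in>\<pi>. k (card V))"
  define k' where "k' = k(Suc n := moment \<mu> (Suc n) - r)"
  have "moment \<mu> i = (\<Sum>\<pi>\<in>noncrossing_partitions i. \<Prod>V\<in>\<pi>. k' (card V))" if i: "i \<in> {1..Suc n}" for i
  proof (cases "i = Suc n")
    case True
    have "(\<Sum>\<pi>\<in>noncrossing_partitions (Suc n) - {{{1..Suc n}}}. \<Prod>V\<in>\<pi>. k' (card V)) = r"
      unfolding r_def
    proof (intro sum.cong prod.cong refl)
      fix \<pi> V assume "\<pi> \<in> noncrossing_partitions (Suc n) - {{{1..Suc n}}}" "V \<in> \<pi>"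
      hence "card V < Suc n" using noncrossing_block_card(3)[of \<pi> "Suc n" V] by blast
      thus "k' (card V) = k (card V)" by (simp add: k'_def)
    qed
    thus ?thesis using True by (simp add: noncrossing_sum_split) (simp add: k'_def)
  next
    case False
    hence "i \<in> {1..n}" using i by auto
    hence "moment \<mu> i = (\<Sum>\<pi>\<in>noncrossing_partitions i. \<Prod>V\<in>\<pi>. k (card V))"
      using k by (simp add: moment_cumulant_eqs_def)
    also have "\<dots> = (\<Sum>\<pi>\<in>noncrossing_partitions i. \<Prod>V\<in>\<pi>. k' (card V))"
    proof (intro sum.cong prod.cong refl)
      fix \<pi> V assume "\<pi> \<in> noncrossing_partitions i" "V \<in> \<pi>"
      hence "card V \<le> i" using noncrossing_block_card(2) by blast
      thus "k (card V) = k' (card V)" using \<open>i \<in> {1..n}\<close> by (simp add: k'_def)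
    qed
    finally show ?thesis .
  qed
  thus ?case unfolding moment_cumulant_eqs_def by blast
qed

lemma moment_cumulant_eqs_unique:
  assumes k: "moment_cumulant_eqs \<mu> n k" and l: "moment_cumulant_eqs \<mu> n l"
    and "1 \<le> i" "i \<le> n"
  shows "k i = l i"
  using assms(3,4)
proof (induction i rule: less_induct)
  case (less i)
  have "(\<Sum>\<pi>\<in>noncrossing_partitions i - {{{1..i}}}. \<Prod>V\<in>\<pi>. k (card V)) =
        (\<Sum>\<pi>\<in>noncrossing_partitions i - {{{1..i}}}. \<Prod>V\<in>\<pi>. l (card V))"
  proof (intro sum.cong prod.cong refl)
    fix \<pi> V assume "\<pi> \<in> noncrossing_partitions i - {{{1..i}}}" "V \<in> \<pi>"
    hence "1 \<le> card V" "card V < i" using noncrossing_block_card[of \<pi> i V] by blast+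
    thus "k (card V) = l (card V)" using less by simp
  qed
  moreover have "moment \<mu> i = (\<Sum>\<pi>\<in>noncrossing_partitions i. \<Prod>V\<in>\<pi>. k (card V))"
    "moment \<mu> i = (\<Sum>\<pi>\<in>noncrossing_partitions i. \<Prod>V\<in>\<pi>. l (card V))"
    using k l less.prems by (simp_all add: moment_cumulant_eqs_def)
  ultimately show ?case
    using less.prems by (simp add: noncrossing_sum_split)
qed

lemma moment_cumulant_eqs_mono:
  "moment_cumulant_eqs \<mu> n k \<Longrightarrow> m \<le> n \<Longrightarrow> moment_cumulant_eqs \<mu> m k"
  by (auto simp: moment_cumulant_eqs_def)

lemma free_cumulant_eqI:
  assumes k: "moment_cumulant_eqs \<mu> n k" and "1 \<le> i" "i \<le> n"
  shows "free_cumulant \<mu> i = k i"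
  unfolding free_cumulant_def
proof (rule the_equality)
  show "\<exists>k'. moment_cumulant_eqs \<mu> i k' \<and> k' i = k i"
    using moment_cumulant_eqs_mono[OF k \<open>i \<le> n\<close>] by blast
  fix x assume "\<exists>k'. moment_cumulant_eqs \<mu> i k' \<and> k' i = x"
  thus "x = k i"
    using moment_cumulant_eqs_unique moment_cumulant_eqs_mono[OF k \<open>i \<le> n\<close>] \<open>1 \<le> i\<close> by blast
qed

lemma free_cumulant_iff:
  "moment_cumulant_eqs \<mu> n k \<longleftrightarrow> (\<forall>i\<in>{1..n}. k i = free_cumulant \<mu> i)"
proof
  assume "moment_cumulant_eqs \<mu> n k"
  thus "\<forall>i\<in>{1..n}. k i = free_cumulant \<mu> i" using free_cumulant_eqI by fastforce
next
  assume eq: "\<forall>i\<in>{1..n}. k i = free_cumulant \<mu> i"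
  obtain l where l: "moment_cumulant_eqs \<mu> n l" using moment_cumulant_eqs_exists by blast
  have lk: "l i = k i" if "i \<in> {1..n}" for i
    using free_cumulant_eqI[OF l, of i] eq that by auto
  have "(\<Sum>\<pi>\<in>noncrossing_partitions i. \<Prod>V\<in>\<pi>. k (card V)) =
        (\<Sum>\<pi>\<in>noncrossing_partitions i. \<Prod>V\<in>\<pi>. l (card V))" if "i \<in> {1..n}" for i
  proof (intro sum.cong prod.cong refl)
    fix \<pi> V assume "\<pi> \<in> noncrossing_partitions i" "V \<in> \<pi>"
    hence "1 \<le> card V" "card V \<le> i" using noncrossing_block_card by blast+
    thus "k (card V) = l (card V)" using lk that by simp
  qed
  thus "moment_cumulant_eqs \<mu> n k" using l by (simp add: moment_cumulant_eqs_def)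
qed


section \<open>Every probability measure on the line has an R-transform\<close>

lemma trunc_cone_mono: "\<beta> \<le> \<beta>' \<Longrightarrow> \<alpha> \<le> \<alpha>' \<Longrightarrow> trunc_cone \<alpha> \<beta> \<subseteq> trunc_cone \<alpha>' \<beta>'" if "\<alpha> > 0"
proof
  fix z assume le: "\<beta> \<le> \<beta>'" "\<alpha> \<le> \<alpha>'" and z: "z \<in> trunc_cone \<alpha> \<beta>"
  have "\<alpha> * (- Im z) > 0" using z by (auto simp: trunc_cone_def)
  hence "- Im z > 0" using that by (simp add: mult_less_0_iff)
  hence "\<alpha> * (- Im z) \<le> \<alpha>' * (- Im z)" using le by (intro mult_right_mono) auto
  thus "z \<in> trunc_cone \<alpha>' \<beta>'" using z le by (auto simp: trunc_cone_def)
qed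

lemma trunc_cone_Im_neg: "\<alpha> > 0 \<Longrightarrow> z \<in> trunc_cone \<alpha> \<beta> \<Longrightarrow> Im z < 0"
  by (auto simp: trunc_cone_def) (smt (verit) mult_nonneg_nonneg)

lemma trunc_cone_resolvent_bound:
  assumes "\<alpha> > 0" "z \<in> trunc_cone \<alpha> \<beta>"
  shows "cmod (1 / (1 - z * complex_of_real t)) \<le> 1 + \<alpha>"
    and "1 - z * complex_of_real t \<noteq> 0"
proof -
  define d where "d = 1 - z * complex_of_real t"
  have y: "Im z < 0" using trunc_cone_Im_neg assms by blast
  have "cmod z \<le> \<bar>Re z\<bar> + \<bar>Im z\<bar>" by (rule cmod_le)
  also have "\<dots> \<le> (1 + \<alpha>) * (- Im z)"
    using assms y by (auto simp: trunc_cone_def algebra_simps)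
  finally have cz: "cmod z \<le> (1 + \<alpha>) * (- Im z)" .
  have "Im (d * cnj z) = - Im z" by (simp add: d_def algebra_simps)
  hence "- Im z \<le> cmod (d * cnj z)" using abs_Im_le_cmod[of "d * cnj z"] y by linarith
  also have "\<dots> = cmod d * cmod z" by (simp add: norm_mult)
  also have "\<dots> \<le> cmod d * ((1 + \<alpha>) * (- Im z))" using cz by (intro mult_left_mono) auto
  finally have "1 * (- Im z) \<le> (cmod d * (1 + \<alpha>)) * (- Im z)" by (simp add: algebra_simps)
  hence le: "1 \<le> cmod d * (1 + \<alpha>)" using y by (subst (asm) mult_le_cancel_right) auto
  hence d0: "d \<noteq> 0" by auto
  thus "1 - z * complex_of_real t \<noteq> 0" by (simp add: d_def)
  show "cmod (1 / (1 - z * complex_of_real t)) \<le> 1 + \<alpha>"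
    using le d0 unfolding d_def[symmetric] by (simp add: norm_divide divide_simps mult.commute)
qed

context real_distribution
begin

abbreviation cauchy_recip :: "complex \<Rightarrow> complex" where "cauchy_recip z \<equiv> cauchy_transform M (1 / z)"

lemma cauchy_transform_near_identity:
  assumes \<alpha>: "\<alpha> > 0"
  shows "\<exists>\<beta>>0. \<forall>z\<in>trunc_cone \<alpha> \<beta>. cmod (cauchy_recip z - z) \<le> cmod z / 4 \<and>
           (\<forall>w\<in>trunc_cone \<alpha> \<beta>. cmod (cauchy_recip z - cauchy_recip w - (z - w)) \<le> cmod (z - w) / 4)"
proof -
  define c where "c = 1 + \<alpha>"
  have c: "c > 1" using \<alpha> by (simp add: c_def)
  define u where "u z t = 1 / (1 - z * complex_of_real t)" for z t
  define g where "g b t = min (c * b * \<bar>t\<bar>) (1 + c)" for b t :: real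
  have [measurable]: "u z \<in> borel_measurable M" for z
    unfolding u_def by measurable
  have [measurable]: "g b \<in> borel_measurable M" for b
    unfolding g_def by measurable
  have g_nn: "0 \<le> g b t" if "b \<ge> 0" for b t
    using that c by (auto simp: g_def)
  have g_int: "integrable M (g b)" if "b \<ge> 0" for b
    using g_nn[OF that] by (intro integrable_const_bound[where B = "1 + c"]) (auto simp: g_def)
  have "(\<lambda>n. \<integral>t. g (1 / real (Suc n)) t \<partial>M) \<longlonglongrightarrow> (\<integral>t. 0 \<partial>M)"
  proof (rule integral_dominated_convergence[where w = "\<lambda>_. 1 + c"])
    show "AE t in M. (\<lambda>n. g (1 / real (Suc n)) t) \<longlonglongrightarrow> 0"
    proof (rule AE_I2)
      fix t
      have "(\<lambda>n. c * (1 / real (Suc n)) * \<bar>t\<bar>) \<longlonglongrightarrow> c * 0 * \<bar>t\<bar>"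
        by (intro tendsto_intros lim_1_over_real_power[of 1, simplified] LIMSEQ_Suc[OF lim_1_over_n])
      hence "(\<lambda>n. min (c * (1 / real (Suc n)) * \<bar>t\<bar>) (1 + c)) \<longlonglongrightarrow> min 0 (1 + c)"
        by (intro tendsto_min tendsto_const) simp
      thus "(\<lambda>n. g (1 / real (Suc n)) t) \<longlonglongrightarrow> 0" using c by (simp add: g_def)
    qed
    show "AE t in M. norm (g (1 / real (Suc n)) t) \<le> 1 + c" for n
      using g_nn[of "1 / real (Suc n)"] by (auto simp: g_def)
  qed auto
  hence "\<forall>\<^sub>F n in sequentially. (\<integral>t. g (1 / real (Suc n)) t \<partial>M) < 1 / (4 * (1 + c))"
    using c by (intro order_tendstoD(2)) auto
  then obtain n where n: "(\<integral>t. g (1 / real (Suc n)) t \<partial>M) < 1 / (4 * (1 + c))"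
    by (auto simp: eventually_sequentially)
  define b where "b = 1 / real (Suc n)"
  have b: "b > 0" by (simp add: b_def)
  have gb: "(1 + c) * (\<integral>t. g b t \<partial>M) \<le> 1 / 4"
    using n[folded b_def] c by (simp add: field_simps)
  have ub: "cmod (u z t) \<le> c" if "z \<in> trunc_cone \<alpha> b" for z t
    using trunc_cone_resolvent_bound(1)[OF \<alpha> that] by (simp add: u_def c_def)
  have nz: "1 - z * complex_of_real t \<noteq> 0" if "z \<in> trunc_cone \<alpha> b" for z t
    using trunc_cone_resolvent_bound(2)[OF \<alpha> that] .
  have u1: "cmod (u z t - 1) \<le> g b t" if z: "z \<in> trunc_cone \<alpha> b" for z t
  proof -
    have "u z t - 1 = u z t * (z * complex_of_real t)"
      using nz[OF z, of t] by (simp add: u_def field_simps)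
    hence "cmod (u z t - 1) = cmod (u z t) * (cmod z * \<bar>t\<bar>)" by (simp add: norm_mult)
    also have "\<dots> \<le> c * (b * \<bar>t\<bar>)"
      using ub[OF z] z c b by (intro mult_mono) (auto simp: trunc_cone_def)
    finally have "cmod (u z t - 1) \<le> c * b * \<bar>t\<bar>" by simp
    moreover have "cmod (u z t - 1) \<le> 1 + c"
      using norm_triangle_ineq4[of "u z t" 1] ub[OF z, of t] by simp
    ultimately show ?thesis by (simp add: g_def)
  qed
  have u_int: "integrable M (u z)" if z: "z \<in> trunc_cone \<alpha> b" for z
    using ub[OF z] by (intro integrable_const_bound[where B = c]) auto
  have uu_int: "integrable M (\<lambda>t. u z t * u w t)"
    if z: "z \<in> trunc_cone \<alpha> b" and w: "w \<in> trunc_cone \<alpha> b" for z w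
    using ub[OF z] ub[OF w] c
    by (intro integrable_const_bound[where B = "c * c"]) (auto simp: norm_mult intro!: mult_mono)
  have PU: "prob UNIV = 1"
    using prob_space by simp
  have z0: "z \<noteq> 0" if "z \<in> trunc_cone \<alpha> b" for z
    using trunc_cone_Im_neg[OF \<alpha> that] by auto
  have cr: "cauchy_recip z = (\<integral>t. z * u z t \<partial>M)" if z: "z \<in> trunc_cone \<alpha> b" for z
    unfolding cauchy_transform_def
  proof (rule Bochner_Integration.integral_cong[OF refl])
    fix t
    have "1 / z - complex_of_real t = (1 - z * complex_of_real t) / z"
      using z0[OF z] by (simp add: field_simps)
    thus "1 / (1 / z - complex_of_real t) = z * u z t" by (simp add: u_def)
  qed
  have bound: "cmod (\<integral>t. h t \<partial>M) \<le> 1 / 4"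
    if "\<And>t. cmod (h t) \<le> (1 + c) * g b t" and [measurable]: "h \<in> borel_measurable M" for h
  proof -
    have gi: "integrable M (\<lambda>t. (1 + c) * g b t)"
      using g_int[of b] b by simp
    have hi: "integrable M h"
    proof (rule Bochner_Integration.integrable_bound[OF gi])
      show "AE t in M. norm (h t) \<le> norm ((1 + c) * g b t)"
      proof (rule AE_I2)
        fix t show "norm (h t) \<le> norm ((1 + c) * g b t)"
          using that(1)[of t] by simp
      qed
    qed (rule that(2))
    have "cmod (\<integral>t. h t \<partial>M) \<le> (\<integral>t. cmod (h t) \<partial>M)"
      by (rule integral_norm_bound)
    also have "\<dots> \<le> (\<integral>t. (1 + c) * g b t \<partial>M)"
      using that(1) by (intro integral_mono integrable_norm hi gi)
    finally have "cmod (\<integral>t. h t \<partial>M) \<le> (1 + c) * (\<integral>t. g b t \<partial>M)"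
      by simp
    thus ?thesis using gb by simp
  qed
  show ?thesis
  proof (intro exI[of _ b] conjI ballI b)
    fix z assume z: "z \<in> trunc_cone \<alpha> b"
    have "cauchy_recip z - z = z * (\<integral>t. u z t - 1 \<partial>M)"
      using u_int[OF z] cr[OF z] by (simp add: algebra_simps PU)
    moreover have "cmod (\<integral>t. u z t - 1 \<partial>M) \<le> 1 / 4"
    proof (rule bound)
      show "cmod (u z t - 1) \<le> (1 + c) * g b t" for t
        using u1[OF z, of t] g_nn[of b t] b c by (auto simp: algebra_simps intro: order_trans)
    qed auto
    ultimately show "cmod (cauchy_recip z - z) \<le> cmod z / 4"
      using mult_left_mono[of "cmod (\<integral>t. u z t - 1 \<partial>M)" "1 / 4" "cmod z"] by (simp add: norm_mult)
    fix w assume w: "w \<in> trunc_cone \<alpha> b"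
    have "cauchy_recip z - cauchy_recip w = (\<integral>t. z * u z t - w * u w t \<partial>M)"
      using u_int[OF z] u_int[OF w] cr[OF z] cr[OF w] by simp
    also have "\<dots> = (\<integral>t. (z - w) * (u z t * u w t) \<partial>M)"
    proof (rule Bochner_Integration.integral_cong[OF refl])
      fix t show "z * u z t - w * u w t = (z - w) * (u z t * u w t)"
        using nz[OF z, of t] nz[OF w, of t] by (simp add: u_def field_simps)
    qed
    finally have "cauchy_recip z - cauchy_recip w - (z - w) = (z - w) * (\<integral>t. u z t * u w t - 1 \<partial>M)"
      using uu_int[OF z w] by (simp add: algebra_simps PU)
    moreover have "cmod (\<integral>t. u z t * u w t - 1 \<partial>M) \<le> 1 / 4"
    proof (rule bound)
      fix t
      have "u z t * u w t - 1 = u z t * (u w t - 1) + (u z t - 1)" by (simp add: algebra_simps)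
      hence "cmod (u z t * u w t - 1) \<le> cmod (u z t) * cmod (u w t - 1) + cmod (u z t - 1)"
        by (metis norm_mult norm_triangle_ineq)
      also have "\<dots> \<le> c * g b t + g b t"
        using ub[OF z] u1[OF z] u1[OF w] c by (intro add_mono mult_mono) auto
      finally show "cmod (u z t * u w t - 1) \<le> (1 + c) * g b t" by (simp add: algebra_simps)
    qed auto
    ultimately show "cmod (cauchy_recip z - cauchy_recip w - (z - w)) \<le> cmod (z - w) / 4"
      using mult_left_mono[of "cmod (\<integral>t. u z t * u w t - 1 \<partial>M)" "1 / 4" "cmod (z - w)"]
      by (simp add: norm_mult)
  qed
qed

lemma R_transform_exists: "\<exists>D R. is_R_transform M D R"
proof -
  define good where "good \<alpha> \<beta> \<longleftrightarrow> (\<forall>z\<in>trunc_cone \<alpha> \<beta>. cmod (cauchy_recip z - z) \<le> cmod z / 4 \<and>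
    (\<forall>w\<in>trunc_cone \<alpha> \<beta>. cmod (cauchy_recip z - cauchy_recip w - (z - w)) \<le> cmod (z - w) / 4))" for \<alpha> \<beta>
  define A where "A = {(\<alpha>, \<beta>). \<alpha> > 0 \<and> \<beta> > 0 \<and> good \<alpha> (2 * \<beta>)}"
  define U where "U = (\<Union>(\<alpha>, \<beta>)\<in>A. trunc_cone \<alpha> \<beta>)"
  have inj_aux: "z = w"
    if A: "(\<alpha>, \<beta>) \<in> A" "(\<alpha>', \<beta>') \<in> A" and z: "z \<in> trunc_cone \<alpha> \<beta>" and w: "w \<in> trunc_cone \<alpha>' \<beta>'"
      and le: "\<alpha> \<le> \<alpha>'" and eq: "cauchy_recip z = cauchy_recip w" for \<alpha> \<beta> \<alpha>' \<beta>' z w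
  proof -
    have pos: "\<alpha> > 0" "\<beta> > 0" "\<alpha>' > 0" "\<beta>' > 0" and g: "good \<alpha> (2 * \<beta>)" "good \<alpha>' (2 * \<beta>')"
      using A by (auto simp: A_def)
    have z2: "z \<in> trunc_cone \<alpha> (2 * \<beta>)"
      using z trunc_cone_mono[of \<alpha> \<beta> "2 * \<beta>" \<alpha>] pos by auto
    have w2: "w \<in> trunc_cone \<alpha>' (2 * \<beta>')"
      using w trunc_cone_mono[of \<alpha>' \<beta>' "2 * \<beta>'" \<alpha>'] pos by auto
    have "cmod (cauchy_recip z - z) \<le> cmod z / 4" "cmod (cauchy_recip w - w) \<le> cmod w / 4"
      using g z2 w2 by (auto simp: good_def)
    hence "3 * cmod z \<le> 5 * cmod w"
      using eq norm_triangle_ineq2[of z "cauchy_recip z"] norm_triangle_ineq2[of "cauchy_recip w" w]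
      by (simp add: norm_minus_commute)
    moreover have "cmod w < \<beta>'" using w by (simp add: trunc_cone_def)
    ultimately have "cmod z < 2 * \<beta>'" using pos by linarith
    hence "z \<in> trunc_cone \<alpha> (2 * \<beta>')" using z by (simp add: trunc_cone_def)
    hence "z \<in> trunc_cone \<alpha>' (2 * \<beta>')"
      using trunc_cone_mono[of \<alpha> "2 * \<beta>'" "2 * \<beta>'" \<alpha>'] pos le by auto
    hence "cmod (cauchy_recip z - cauchy_recip w - (z - w)) \<le> cmod (z - w) / 4"
      using g(2) w2 by (auto simp: good_def)
    hence "cmod (z - w) \<le> cmod (z - w) / 4" using eq by (simp add: norm_minus_commute)
    thus "z = w" by simp
  qed
  have inj: "inj_on cauchy_recip U"
  proof (rule inj_onI)
    fix z w assume "z \<in> U" "w \<in> U" and eq: "cauchy_recip z = cauchy_recip w"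
    then obtain \<alpha> \<beta> \<alpha>' \<beta>' where *: "(\<alpha>, \<beta>) \<in> A" "(\<alpha>', \<beta>') \<in> A"
      "z \<in> trunc_cone \<alpha> \<beta>" "w \<in> trunc_cone \<alpha>' \<beta>'"
      by (auto simp: U_def)
    show "z = w"
      using inj_aux[OF *(1,2,3,4) _ eq] inj_aux[OF *(2,1,4,3) _ eq[symmetric]] linear by metis
  qed
  define L where "L = inv_into U cauchy_recip"
  have "is_R_transform M (\<Union>(\<alpha>, \<beta>)\<in>A. cauchy_recip ` trunc_cone \<alpha> \<beta>) (\<lambda>w. 1 / L w - 1 / w)"
    unfolding is_R_transform_def
  proof (intro exI[of _ A] exI[of _ L] conjI refl ballI allI impI)
    show "case x of (\<alpha>, \<beta>) \<Rightarrow> \<alpha> > 0 \<and> \<beta> > 0" if "x \<in> A" for x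
      using that by (auto simp: A_def)
    show "case x of (\<alpha>, \<beta>) \<Rightarrow> \<forall>z\<in>trunc_cone \<alpha> \<beta>. L (cauchy_recip z) = z" if "x \<in> A" for x
      using that inj unfolding L_def by (auto simp: U_def intro!: inv_into_f_f)
    show "\<forall>\<^sub>F \<beta> in at_right 0. (\<alpha>, \<beta>) \<in> A" if \<alpha>: "\<alpha> > 0" for \<alpha>
    proof -
      obtain b where b: "b > 0" "good \<alpha> b"
        using cauchy_transform_near_identity[OF \<alpha>] unfolding good_def by blast
      have "(\<alpha>, \<beta>) \<in> A" if "0 < \<beta>" "\<beta> < b / 2" for \<beta>
      proof -
        have "trunc_cone \<alpha> (2 * \<beta>) \<subseteq> trunc_cone \<alpha> b"
          using trunc_cone_mono[of \<alpha> "2 * \<beta>" b \<alpha>] \<alpha> that by auto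
        hence "good \<alpha> (2 * \<beta>)" using b(2) unfolding good_def by blast
        thus ?thesis using \<alpha> that by (simp add: A_def)
      qed
      thus ?thesis using b(1) by (auto simp: eventually_at_right_field intro!: exI[of _ "b / 2"])
    qed
  qed
  thus ?thesis by blast
qed

end

end

theory Submission
  imports Defs "HOL-Library.Landau_Symbols"
begin

text \<open>
  Write \<open>h(z) = \<integral> 1 / (1 - z t) d\<mu>(t)\<close>, so that \<open>w = G\<^sub>\<mu>(1/z) = z h(z)\<close> and \<open>1 + w R\<^sub>\<mu>(w) = h(z)\<close>. As \<open>h \<rightarrow> 1\<close>
  non-tangentially, \<open>z\<close> and \<open>w\<close> are interchangeable in error terms. If \<open>\<mu>\<close> has a \<open>p\<close>-th moment, then
  \<open>h(z) = M(z) + o(z\<^sup>p)\<close> with the truncated moment series \<open>M\<close>, and the moment-cumulant formula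
  \<open>M(z) = C(z M(z)) + O(z\<^bsup>p+1\<^esup>)\<close> gives \<open>h(z) = C(w) + o(w\<^sup>p)\<close>, which is the expansion of \<open>R\<^sub>\<mu>\<close>.
  Conversely, an expansion of \<open>R\<^sub>\<mu>\<close> is an implicit equation \<open>h(z) = C(z h(z)) + o(z\<^sup>p)\<close>, which is solved
  by iteration to yield an expansion of \<open>h\<close> with real coefficients. On the imaginary axis its real and
  imaginary parts bound the integrals of \<open>t\<^sup>m / (1 + y\<^sup>2 t\<^sup>2)\<close> as \<open>y \<rightarrow> 0\<close>, and Fatou's lemma gives the moments
  one after the other.
\<close>

section \<open>Non-crossing partitions\<close>

text \<open>Non-tangential approach makes the estimates uniform in t: on a cone of slope \<alpha>
  both |1/(1 - zt)| and |zt/(1 - zt)| are bounded by constants depending on \<alpha> alone, so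
  limits pass under the integral. Two features shape the rest. First, R lives on images of cones, so
  a limit in z says something about w only if small cones in w are covered by such images;
  statements can be transported in both directions, at the cost of widening the slope by 1. Second,
  real coefficients are decisive in the converse: for the Cauchy distribution G(z) = 1/(z + i) and R
  is the constant -i, which has expansions of every order although there is no first moment. With
  real coefficients the imaginary part at z = -iy loses its constant term, and dividing it by y
  controls the next even moment. Moments are therefore gained two at a time, and only a last odd
  one, whose integrand changes sign, calls for a support bounded on one side.\<close>

definition nc_on :: "nat set \<Rightarrow> nat set set set"
  where "nc_on S = {\<pi>. partition_on S \<pi> \<and>
           \<not> (\<exists>j1 j2 j3 j4. \<exists>V\<in>\<pi>. \<exists>W\<in>\<pi>. V \<noteq> W \<and> j1 < j2 \<and> j2 < j3 \<and> j3 < j4 \<and>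
                 j1 \<in> V \<and> j3 \<in> V \<and> j2 \<in> W \<and> j4 \<in> W)}"

text \<open>Taking a union gives the value \<open>{}\<close> when no block contains
  \<open>x\<close>. This default lets the empty interval, and a block of \<open>a\<close> without
  further elements, be treated like the other cases.\<close>

definition block_of :: "'a \<Rightarrow> 'a set set \<Rightarrow> 'a set"
  where "block_of x \<pi> = \<Union>{B \<in> \<pi>. x \<in> B}"

text \<open>
  The parameter \<open>j\<close> counts the elements of the block of \<open>a\<close> that have been split off on its left. For
  \<open>a = b\<close> nothing but these is left of the block, and \<open>nc_sum k j a a = k j\<close>.
\<close>

definition nc_weight :: "(nat \<Rightarrow> 'a::comm_semiring_1) \<Rightarrow> nat \<Rightarrow> nat \<Rightarrow> nat set set \<Rightarrow> 'a"
  where "nc_weight k j a \<pi> = k (card (block_of a \<pi>) + j) * (\<Prod>B\<in>{B\<in>\<pi>. a \<notin> B}. k (card B))"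

definition nc_sum :: "(nat \<Rightarrow> 'a::comm_semiring_1) \<Rightarrow> nat \<Rightarrow> nat \<Rightarrow> nat \<Rightarrow> 'a"
  where "nc_sum k j a b = (\<Sum>\<pi>\<in>nc_on {a..<b}. nc_weight k j a \<pi>)"

lemma nc_on_D:
  assumes "\<pi> \<in> nc_on S"
  shows "\<Union>\<pi> = S" "\<And>V W. V \<in> \<pi> \<Longrightarrow> W \<in> \<pi> \<Longrightarrow> V \<noteq> W \<Longrightarrow> V \<inter> W = {}" "{} \<notin> \<pi>"
    "\<And>V W j1 j2 j3 j4. V \<in> \<pi> \<Longrightarrow> W \<in> \<pi> \<Longrightarrow> j1 \<in> V \<Longrightarrow> j3 \<in> V \<Longrightarrow> j2 \<in> W \<Longrightarrow> j4 \<in> W \<Longrightarrow>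
       j1 < j2 \<Longrightarrow> j2 < j3 \<Longrightarrow> j3 < j4 \<Longrightarrow> V = W"
proof -
  note * = assms[unfolded nc_on_def mem_Collect_eq]
  note part = *[THEN conjunct1] and nc = *[THEN conjunct2]
  show "\<Union>\<pi> = S" "{} \<notin> \<pi>" using part by (auto simp: partition_on_def)
  show "V \<inter> W = {}" if "V \<in> \<pi>" "W \<in> \<pi>" "V \<noteq> W" for V W
    using partition_onD2[OF part] that by (simp add: disjoint_def)
  show "V = W" if "V \<in> \<pi>" "W \<in> \<pi>" "j1 \<in> V" "j3 \<in> V" "j2 \<in> W" "j4 \<in> W" "j1 < j2" "j2 < j3" "j3 < j4"
    for V W j1 j2 j3 j4
  proof (rule ccontr)
    assume "V \<noteq> W"
    show False
      by (rule notE[OF nc], rule exI[of _ j1], rule exI[of _ j2], rule exI[of _ j3], rule exI[of _ j4],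
          rule bexI[OF _ that(1)], rule bexI[OF _ that(2)]) (use that \<open>V \<noteq> W\<close> in simp)
  qed
qed

lemma nc_on_I:
  assumes "\<Union>\<pi> = S" "\<And>V W. V \<in> \<pi> \<Longrightarrow> W \<in> \<pi> \<Longrightarrow> V \<noteq> W \<Longrightarrow> V \<inter> W = {}" "{} \<notin> \<pi>"
    "\<And>V W j1 j2 j3 j4. V \<in> \<pi> \<Longrightarrow> W \<in> \<pi> \<Longrightarrow> V \<noteq> W \<Longrightarrow> j1 \<in> V \<Longrightarrow> j3 \<in> V \<Longrightarrow> j2 \<in> W \<Longrightarrow> j4 \<in> W \<Longrightarrow>
       j1 < j2 \<Longrightarrow> j2 < j3 \<Longrightarrow> j3 < j4 \<Longrightarrow> False"
  shows "\<pi> \<in> nc_on S"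
proof -
  have part: "partition_on S \<pi>"
    unfolding partition_on_def disjoint_def using assms(1-3) by (intro conjI ballI impI) simp_all
  show ?thesis
    unfolding nc_on_def mem_Collect_eq
  proof (intro conjI notI, rule part, elim exE bexE conjE)
    fix j1 j2 j3 j4 V W
    assume "V \<in> \<pi>" "W \<in> \<pi>" "V \<noteq> W" "j1 < j2" "j2 < j3" "j3 < j4" "j1 \<in> V" "j3 \<in> V" "j2 \<in> W" "j4 \<in> W"
    thus False using assms(4)[of V W j1 j3 j2 j4] by simp
  qed
qed

lemma finite_nc_on: "finite S \<Longrightarrow> finite (nc_on S)"
  by (rule finite_subset[OF _ finitely_many_partition_on[of S]]) (auto simp: nc_on_def)

lemma finite_nc_on_elem: "finite S \<Longrightarrow> \<pi> \<in> nc_on S \<Longrightarrow> finite \<pi>"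
  by (auto simp: nc_on_def intro: finite_elements)

lemma block_of_mem:
  assumes "\<pi> \<in> nc_on S" "x \<in> S"
  shows "block_of x \<pi> \<in> \<pi>" "x \<in> block_of x \<pi>"
proof -
  obtain B where B: "B \<in> \<pi>" "x \<in> B" using nc_on_D(1)[OF assms(1)] assms(2) by blast
  have "block_of x \<pi> = B" unfolding block_of_def using B nc_on_D(2)[OF assms(1), of B] by blast
  thus "block_of x \<pi> \<in> \<pi>" "x \<in> block_of x \<pi>" using B by auto
qed

lemma block_of_eq: "\<pi> \<in> nc_on S \<Longrightarrow> B \<in> \<pi> \<Longrightarrow> x \<in> B \<Longrightarrow> block_of x \<pi> = B"
  unfolding block_of_def using nc_on_D(2)[of \<pi> S B] by blast

lemma block_of_notin: "\<pi> \<in> nc_on S \<Longrightarrow> x \<notin> S \<Longrightarrow> block_of x \<pi> = {}"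
  unfolding block_of_def using nc_on_D(1)[of \<pi> S] by blast

lemma block_of_subset: "\<pi> \<in> nc_on S \<Longrightarrow> block_of x \<pi> \<subseteq> S"
  unfolding block_of_def using nc_on_D(1)[of \<pi> S] by blast

section \<open>Cutting a non-crossing partition at the second element of its first block\<close>

definition nc_join :: "nat \<Rightarrow> nat \<Rightarrow> nat set set \<Rightarrow> nat set set \<Rightarrow> nat set set"
  where "nc_join a v \<sigma> \<tau> = insert (insert a (block_of v \<tau>)) (\<sigma> \<union> {B \<in> \<tau>. v \<notin> B})"

context
  fixes a v b :: nat
  assumes av: "a < v" and vb: "v \<le> b"
begin

lemma nc_join_cases:
  assumes s: "\<sigma> \<in> nc_on {a<..<v}" and t: "\<tau> \<in> nc_on {v..<b}"
  shows "v < b \<and> block_of v \<tau> \<in> \<tau> \<and> v \<in> block_of v \<tau> \<or> v = b \<and> \<tau> = {} \<and> block_of v \<tau> = {}"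
proof (cases "v < b")
  case True
  thus ?thesis using block_of_mem[OF t, of v] by auto
next
  case False
  hence "v = b" using vb by simp
  moreover from this have "\<tau> = {}" using nc_on_D(1,3)[OF t] by (metis Union_empty_conv atLeastLessThan_empty order_refl subsetI subset_singletonD insert_iff subset_eq)
  ultimately show ?thesis by (simp add: block_of_def)
qed

text \<open>Blocks of \<open>\<sigma>\<close> sit inside the gap between \<open>a\<close> and
  \<open>v\<close>, where no other block has elements, so they cross nothing outside. A crossing
  that uses the new element \<open>a\<close> would stay a crossing with \<open>v\<close> in place of
  \<open>a\<close>, which \<open>\<tau>\<close> excludes.\<close>

lemma nc_join_mem:
  assumes s: "\<sigma> \<in> nc_on {a<..<v}" and t: "\<tau> \<in> nc_on {v..<b}"
  shows "nc_join a v \<sigma> \<tau> \<in> nc_on {a..<b}"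
proof (rule nc_on_I)
  let ?V = "insert a (block_of v \<tau>)"
  note c = nc_join_cases[OF s t]
  have ss: "\<And>B x. B \<in> \<sigma> \<Longrightarrow> x \<in> B \<Longrightarrow> a < x \<and> x < v" using nc_on_D(1)[OF s] by auto
  have tt: "\<And>B x. B \<in> \<tau> \<Longrightarrow> x \<in> B \<Longrightarrow> v \<le> x \<and> x < b" using nc_on_D(1)[OF t] by auto
  have bt: "\<And>x. x \<in> block_of v \<tau> \<Longrightarrow> v \<le> x \<and> x < b" using block_of_subset[OF t, of v] by auto
  have "\<Union>\<tau> = block_of v \<tau> \<union> \<Union>{B \<in> \<tau>. v \<notin> B}" unfolding block_of_def by blast
  hence "\<Union>(nc_join a v \<sigma> \<tau>) = insert a (\<Union>\<sigma> \<union> \<Union>\<tau>)" by (simp add: nc_join_def Un_ac)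
  also have "\<dots> = {a..<b}" using nc_on_D(1)[OF s] nc_on_D(1)[OF t] av vb by auto
  finally show "\<Union>(nc_join a v \<sigma> \<tau>) = {a..<b}" .
  show "{} \<notin> nc_join a v \<sigma> \<tau>"
    using nc_on_D(3)[OF s] nc_on_D(3)[OF t] by (auto simp: nc_join_def)
  have bd: "block_of v \<tau> \<inter> W = {}" if "W \<in> \<tau>" "v \<notin> W" for W
    using c nc_on_D(2)[OF t, of "block_of v \<tau>" W] that by auto
  show "V \<inter> W = {}" if "V \<in> nc_join a v \<sigma> \<tau>" "W \<in> nc_join a v \<sigma> \<tau>" "V \<noteq> W" for V W
  proof -
    have st: "B \<inter> C = {}" if "B \<in> \<sigma>" "C \<in> \<tau>" for B C
    proof (rule equals0I)
      fix x assume "x \<in> B \<inter> C"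
      thus False using ss[OF that(1), of x] tt[OF that(2), of x] by simp
    qed
    have sV: "B \<inter> ?V = {}" if "B \<in> \<sigma>" for B
    proof (rule equals0I)
      fix x assume "x \<in> B \<inter> ?V"
      thus False using ss[OF that, of x] bt[of x] by auto
    qed
    have tV: "C \<inter> ?V = {}" if "C \<in> \<tau>" "v \<notin> C" for C
    proof (rule equals0I)
      fix x assume "x \<in> C \<inter> ?V"
      thus False using tt[OF that(1), of x] bd[OF that] av by auto
    qed
    have "V = ?V \<or> V \<in> \<sigma> \<or> V \<in> \<tau> \<and> v \<notin> V" "W = ?V \<or> W \<in> \<sigma> \<or> W \<in> \<tau> \<and> v \<notin> W"
      using that(1,2) by (simp_all add: nc_join_def)
    thus ?thesis
      using that(3) st[of V W] st[of W V] sV[of V] sV[of W] tV[of V] tV[of W]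
        nc_on_D(2)[OF s, of V W] nc_on_D(2)[OF t, of V W]
      by (metis Int_commute)
  qed
  fix V W j1 j2 j3 j4
  assume V: "V \<in> nc_join a v \<sigma> \<tau>" and W: "W \<in> nc_join a v \<sigma> \<tau>" and "V \<noteq> W"
    and j: "j1 \<in> V" "j3 \<in> V" "j2 \<in> W" "j4 \<in> W" "j1 < j2" "j2 < j3" "j3 < j4"
  have outer: "x = a \<or> v \<le> x" if "x \<in> B" "B \<in> nc_join a v \<sigma> \<tau>" "B \<notin> \<sigma>" for x B
    using that bt tt unfolding nc_join_def by auto
  show False
  proof (cases "V \<in> \<sigma>")
    case True
    hence "W \<in> \<sigma>" using outer[OF j(3) W] ss[OF True j(1)] ss[OF True j(2)] j(5,6) by linarith
    thus False using True nc_on_D(4)[OF s True] j \<open>V \<noteq> W\<close> by blast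
  next
    case V': False
    hence W': "W \<notin> \<sigma>" using outer[OF j(2) V V'] ss[of W, OF _ j(3)] ss[of W, OF _ j(4)] j(6,7) by linarith
    have ja: "a \<le> j1" using outer[OF j(1) V V'] av by auto
    have WT: "W \<in> \<tau>" "v \<notin> W" if "W \<noteq> ?V" using W W' that by (auto simp: nc_join_def)
    have VT: "V \<in> \<tau>" "v \<notin> V" if "V \<noteq> ?V" using V V' that by (auto simp: nc_join_def)
    show False
    proof (cases "V = ?V")
      case True
      hence w: "W \<in> \<tau>" "v \<notin> W" using WT \<open>V \<noteq> W\<close> by auto
      have "j3 \<in> block_of v \<tau>" using True j(2) ja j by auto
      hence "block_of v \<tau> \<in> \<tau>" "v \<in> block_of v \<tau>" using c by auto
      moreover have "v < j2" using tt[OF w(1) j(3)] w(2) j(3) by (metis le_neq_implies_less)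
      ultimately have "block_of v \<tau> = W"
        using nc_on_D(4)[OF t, of "block_of v \<tau>" W v j3 j2 j4] w j \<open>j3 \<in> block_of v \<tau>\<close> by blast
      thus False using w \<open>v \<in> block_of v \<tau>\<close> by blast
    next
      case False
      note vt = VT[OF False]
      show False
      proof (cases "W = ?V")
        case True
        have "j2 \<in> block_of v \<tau>" "j4 \<in> block_of v \<tau>" using True j ja by auto
        hence "block_of v \<tau> \<in> \<tau>" "v \<in> block_of v \<tau>" using c by auto
        hence "V = block_of v \<tau>"
          using nc_on_D(4)[OF t vt(1), of "block_of v \<tau>" j1 j3 j2 j4] j \<open>j2 \<in> block_of v \<tau>\<close> \<open>j4 \<in> block_of v \<tau>\<close> by blast
        thus False using vt \<open>v \<in> block_of v \<tau>\<close> by blast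
      next
        case False
        thus False using nc_on_D(4)[OF t vt(1) WT(1)[OF False]] j \<open>V \<noteq> W\<close> by blast
      qed
    qed
  qed
qed

text \<open>The third part recovers the cut point \<open>v\<close> from the joined partition: it is
  the second smallest element of the block of \<open>a\<close>, with \<open>b\<close> as the default
  for a singleton block.\<close>

lemma block_of_nc_join:
  assumes s: "\<sigma> \<in> nc_on {a<..<v}" and t: "\<tau> \<in> nc_on {v..<b}"
  shows "block_of a (nc_join a v \<sigma> \<tau>) = insert a (block_of v \<tau>)"
    "{B \<in> nc_join a v \<sigma> \<tau>. a \<notin> B} = \<sigma> \<union> {B \<in> \<tau>. v \<notin> B}"
    "Min (insert b (block_of a (nc_join a v \<sigma> \<tau>) - {a})) = v"
proof -
  have na: "a \<notin> B" if "B \<in> \<sigma> \<or> B \<in> \<tau>" for B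
  proof
    assume "a \<in> B"
    hence "a \<in> \<Union>\<sigma> \<or> a \<in> \<Union>\<tau>" using that by blast
    thus False using nc_on_D(1)[OF s] nc_on_D(1)[OF t] av by simp
  qed
  show 1: "block_of a (nc_join a v \<sigma> \<tau>) = insert a (block_of v \<tau>)"
    by (rule block_of_eq[OF nc_join_mem[OF s t]]) (auto simp: nc_join_def)
  show "{B \<in> nc_join a v \<sigma> \<tau>. a \<notin> B} = \<sigma> \<union> {B \<in> \<tau>. v \<notin> B}"
    using na by (auto simp: nc_join_def)
  have sub: "block_of v \<tau> \<subseteq> {v..<b}" by (rule block_of_subset[OF t])
  hence eq: "insert a (block_of v \<tau>) - {a} = block_of v \<tau>" using av by auto
  show "Min (insert b (block_of a (nc_join a v \<sigma> \<tau>) - {a})) = v"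
    unfolding 1 eq using sub vb nc_join_cases[OF s t]
    by (intro Min_eqI) (auto intro: finite_subset)
qed

text \<open>The element \<open>a\<close> moves from its block into the counter, which is why
  \<open>j\<close> becomes \<open>Suc j\<close>. For \<open>v = b\<close> the right factor is the
  weight \<open>k (Suc j)\<close> of the empty partition.\<close>

lemma nc_weight_join:
  assumes s: "\<sigma> \<in> nc_on {a<..<v}" and t: "\<tau> \<in> nc_on {v..<b}"
  shows "nc_weight k j a (nc_join a v \<sigma> \<tau>) = (\<Prod>B\<in>\<sigma>. k (card B)) * nc_weight k (Suc j) v \<tau>"
proof -
  have sub: "block_of v \<tau> \<subseteq> {v..<b}" by (rule block_of_subset[OF t])
  have "\<sigma> \<inter> \<tau> = {}"
  proof (rule ccontr)
    assume "\<sigma> \<inter> \<tau> \<noteq> {}"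
    then obtain B where B: "B \<in> \<sigma>" "B \<in> \<tau>" by blast
    hence "B \<noteq> {}" using nc_on_D(3)[OF s] by blast
    moreover have "B \<subseteq> {a<..<v}" "B \<subseteq> {v..<b}" using B nc_on_D(1)[OF s] nc_on_D(1)[OF t] by auto
    ultimately show False by fastforce
  qed
  hence "(\<Prod>B\<in>\<sigma> \<union> {B \<in> \<tau>. v \<notin> B}. k (card B)) = (\<Prod>B\<in>\<sigma>. k (card B)) * (\<Prod>B\<in>{B \<in> \<tau>. v \<notin> B}. k (card B))"
    using finite_nc_on_elem[OF _ s] finite_nc_on_elem[OF _ t] by (intro prod.union_disjoint) auto
  moreover have "card (insert a (block_of v \<tau>)) = Suc (card (block_of v \<tau>))"
    using sub av by (intro card_insert_disjoint) (auto intro: finite_subset)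
  ultimately show ?thesis
    unfolding nc_weight_def block_of_nc_join[OF s t] by (simp add: mult_ac)
qed

end

definition nc_inner :: "nat \<Rightarrow> nat \<Rightarrow> nat set set \<Rightarrow> nat set set"
  where "nc_inner a v \<pi> = {B \<in> \<pi>. B \<subseteq> {a<..<v}}"

text \<open>Removing \<open>a\<close> from a singleton block leaves \<open>{}\<close>, which must
  not survive as a block.\<close>

definition nc_outer :: "nat \<Rightarrow> nat \<Rightarrow> nat set set \<Rightarrow> nat set set"
  where "nc_outer a v \<pi> = ({B \<in> \<pi>. a \<notin> B \<and> \<not> B \<subseteq> {a<..<v}} \<union> {block_of a \<pi> - {a}}) - {{}}"

text \<open>Together with \<open>nc_split_join\<close> this makes \<open>nc_join\<close> a bijection
  onto the partitions of \<open>{a..<b}\<close>, with the cut point \<open>v\<close> ranging over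
  \<open>{a<..b}\<close>.\<close>

lemma nc_split:
  assumes p: "\<pi> \<in> nc_on {a..<b}" and ab: "a < b"
  defines "v \<equiv> Min (insert b (block_of a \<pi> - {a}))"
  shows "a < v" "v \<le> b" "nc_inner a v \<pi> \<in> nc_on {a<..<v}" "nc_outer a v \<pi> \<in> nc_on {v..<b}"
    "nc_join a v (nc_inner a v \<pi>) (nc_outer a v \<pi>) = \<pi>"
proof -
  define V where "V = block_of a \<pi>"
  have V: "V \<in> \<pi>" "a \<in> V" using block_of_mem[OF p, of a] ab by (auto simp: V_def)
  have Vs: "V \<subseteq> {a..<b}" using block_of_subset[OF p] by (simp add: V_def)
  have fin: "finite (V - {a})" using Vs by (auto intro: finite_subset)
  have vdef: "v = Min (insert b (V - {a}))" by (simp add: v_def V_def)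
  show av: "a < v" unfolding vdef using Vs ab fin by (subst Min_gr_iff) auto
  show vb: "v \<le> b" unfolding vdef using fin by auto
  have vV: "v \<in> V \<or> v = b" using Min_in[of "insert b (V - {a})"] fin unfolding vdef by auto
  have Vv: "v \<le> x" if "x \<in> V" "x \<noteq> a" for x unfolding vdef using that fin by auto
  have Vlt: "x < b" if "x \<in> V" for x using Vs that by auto
  have ps: "B \<subseteq> {a..<b}" if "B \<in> \<pi>" for B using nc_on_D(1)[OF p] that by auto
  have uniq: "B = V" if "B \<in> \<pi>" "x \<in> B" "x \<in> V" for B x using nc_on_D(2)[OF p that(1) V(1)] that by blast
  \<comment> \<open>A block meeting both \<open>(a, v)\<close> and \<open>[v, b)\<close> would cross the block of \<open>a\<close>, which contains \<open>v\<close>.\<close>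
  have dich: "B \<subseteq> {v..<b}" if B: "B \<in> \<pi>" "a \<notin> B" "\<not> B \<subseteq> {a<..<v}" for B
  proof (rule ccontr)
    assume n: "\<not> B \<subseteq> {v..<b}"
    have "B \<subseteq> {a<..<b}" using ps[OF B(1)] B(2) by (auto simp: less_le)
    then obtain x y where xy: "x \<in> B" "a < x" "x < v" "y \<in> B" "v \<le> y" "y < b"
      using n B(3) by (auto simp: subset_iff)
    have "v \<in> V" using vV xy by auto
    moreover from this have "v \<noteq> y" using uniq[OF B(1) xy(4)] B(2) V(2) by auto
    ultimately have "V = B" using nc_on_D(4)[OF p V(1) B(1), of a v x y] xy V by auto
    thus False using V B by blast
  qed
  have out: "nc_outer a v \<pi> = {B \<in> \<pi>. a \<notin> B \<and> \<not> B \<subseteq> {a<..<v}} \<union> ({V - {a}} - {{}})"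
    unfolding nc_outer_def V_def[symmetric] by auto
  have inn: "\<Union>(nc_inner a v \<pi>) = {a<..<v}"
  proof
    show "\<Union>(nc_inner a v \<pi>) \<subseteq> {a<..<v}" by (auto simp: nc_inner_def)
    show "{a<..<v} \<subseteq> \<Union>(nc_inner a v \<pi>)"
    proof
      fix x assume x: "x \<in> {a<..<v}"
      hence "x \<in> {a..<b}" using vb by auto
      then obtain B where B: "B \<in> \<pi>" "x \<in> B" using nc_on_D(1)[OF p] by blast
      have "B \<noteq> V" using Vv[of x] B x by auto
      hence "a \<notin> B" using uniq[OF B(1)] V(2) by blast
      hence "B \<subseteq> {a<..<v}" using dich[OF B(1)] B(2) x by force
      thus "x \<in> \<Union>(nc_inner a v \<pi>)" using B by (auto simp: nc_inner_def)
    qed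
  qed
  show i: "nc_inner a v \<pi> \<in> nc_on {a<..<v}"
    by (rule nc_on_I[OF inn]) (use nc_on_D(2,3,4)[OF p] in \<open>auto simp: nc_inner_def\<close>)
  have lift: "\<exists>B'\<in>\<pi>. B \<subseteq> B' \<and> (B \<noteq> B' \<longrightarrow> B' = V \<and> B = V - {a})" if "B \<in> nc_outer a v \<pi>" for B
    using that V unfolding out by auto
  show o: "nc_outer a v \<pi> \<in> nc_on {v..<b}"
  proof (rule nc_on_I)
    show "\<Union>(nc_outer a v \<pi>) = {v..<b}"
    proof
      show "\<Union>(nc_outer a v \<pi>) \<subseteq> {v..<b}" unfolding out using dich Vv Vlt by fastforce
      show "{v..<b} \<subseteq> \<Union>(nc_outer a v \<pi>)"
      proof
        fix x assume x: "x \<in> {v..<b}"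
        hence "x \<in> {a..<b}" using av by auto
        then obtain B where B: "B \<in> \<pi>" "x \<in> B" using nc_on_D(1)[OF p] by blast
        show "x \<in> \<Union>(nc_outer a v \<pi>)"
        proof (cases "B = V")
          case True thus ?thesis using B x av unfolding out by auto
        next
          case False
          hence "a \<notin> B" using uniq[OF B(1)] V(2) by blast
          moreover have "\<not> B \<subseteq> {a<..<v}" using B x by auto
          ultimately show ?thesis using B unfolding out by auto
        qed
      qed
    qed
    show "{} \<notin> nc_outer a v \<pi>" by (simp add: nc_outer_def)
    \<comment> \<open>Distinct outer blocks lie in distinct blocks of \<open>\<pi>\<close>, so
      disjointness and the absence of crossings are inherited.\<close>
    have eqV: "B = C" if "B \<in> nc_outer a v \<pi>" "C \<in> nc_outer a v \<pi>" "B \<subseteq> B'" "C \<subseteq> B'" "B' \<in> \<pi>" for B C B'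
    proof -
      have ne: "B \<noteq> {}" "C \<noteq> {}" using that by (auto simp: nc_outer_def)
      have *: "X = (if B' = V then V - {a} else B')" if X: "X \<in> nc_outer a v \<pi>" "X \<subseteq> B'" "X \<noteq> {}" for X
      proof -
        obtain X' where X': "X' \<in> \<pi>" "X \<subseteq> X'" "X \<noteq> X' \<longrightarrow> X' = V \<and> X = V - {a}" using lift[OF X(1)] by blast
        have "X' = B'" using nc_on_D(2)[OF p X'(1) \<open>B' \<in> \<pi>\<close>] X X' by blast
        thus ?thesis using X X' V uniq unfolding out by auto
      qed
      show ?thesis using *[OF that(1,3) ne(1)] *[OF that(2,4) ne(2)] by simp
    qed
    show "B \<inter> C = {}" if "B \<in> nc_outer a v \<pi>" "C \<in> nc_outer a v \<pi>" "B \<noteq> C" for B C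
    proof -
      obtain B' C' where *: "B' \<in> \<pi>" "B \<subseteq> B'" "C' \<in> \<pi>" "C \<subseteq> C'"
        using lift[OF \<open>B \<in> _\<close>] lift[OF \<open>C \<in> _\<close>] by auto
      have "B' \<noteq> C'" using eqV[OF that(1,2), of B'] * that by blast
      thus ?thesis using nc_on_D(2)[OF p *(1,3)] * by blast
    qed
    fix B C j1 j2 j3 j4
    assume A: "B \<in> nc_outer a v \<pi>" "C \<in> nc_outer a v \<pi>" "B \<noteq> C" "j1 \<in> B" "j3 \<in> B" "j2 \<in> C" "j4 \<in> C"
       "j1 < j2" "j2 < j3" "j3 < j4"
    obtain B' C' where *: "B' \<in> \<pi>" "B \<subseteq> B'" "C' \<in> \<pi>" "C \<subseteq> C'"
      using lift[OF A(1)] lift[OF A(2)] by auto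
    have "B' \<noteq> C'" using eqV[OF A(1,2), of B'] * A by blast
    thus False using nc_on_D(4)[OF p *(1,3)] * A by blast
  qed
  have bl: "block_of v (nc_outer a v \<pi>) = V - {a}"
  proof (cases "v \<in> V")
    case True
    thus ?thesis using av by (intro block_of_eq[OF o]) (auto simp: out)
  next
    case False
    hence "v = b" using vV by simp
    hence "V - {a} = {}" using Vv Vlt by (metis Diff_eq_empty_iff leD singleton_iff subsetI)
    thus ?thesis using \<open>v = b\<close> block_of_notin[OF o] by simp
  qed
  have "{B \<in> nc_outer a v \<pi>. v \<notin> B} = {B \<in> \<pi>. a \<notin> B \<and> \<not> B \<subseteq> {a<..<v}}"
  proof -
    have "v \<in> V - {a} \<or> V - {a} = {}" using vV av Vv Vlt by (metis DiffI Diff_eq_empty_iff leD less_irrefl singleton_iff subsetI)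
    moreover have "v \<notin> B" if "B \<in> \<pi>" "a \<notin> B" "\<not> B \<subseteq> {a<..<v}" for B
    proof
      assume "v \<in> B"
      hence "v \<noteq> b" using ps[OF that(1)] by auto
      hence "B = V" using vV uniq[OF that(1) \<open>v \<in> B\<close>] by blast
      thus False using that V by blast
    qed
    ultimately show ?thesis unfolding out by auto
  qed
  moreover have "insert a (V - {a}) = V" using V by auto
  ultimately have "nc_join a v (nc_inner a v \<pi>) (nc_outer a v \<pi>) =
      insert V ({B \<in> \<pi>. B \<subseteq> {a<..<v}} \<union> {B \<in> \<pi>. a \<notin> B \<and> \<not> B \<subseteq> {a<..<v}})"
    unfolding nc_join_def bl by (simp add: nc_inner_def)
  also have "\<dots> = \<pi>" using V uniq by auto
  finally show "nc_join a v (nc_inner a v \<pi>) (nc_outer a v \<pi>) = \<pi>" .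
qed

lemma nc_split_join:
  assumes "a < v" "v \<le> b" and s: "\<sigma> \<in> nc_on {a<..<v}" and t: "\<tau> \<in> nc_on {v..<b}"
  shows "nc_inner a v (nc_join a v \<sigma> \<tau>) = \<sigma>" "nc_outer a v (nc_join a v \<sigma> \<tau>) = \<tau>"
proof -
  note bl = block_of_nc_join[OF assms]
  note c = nc_join_cases[OF assms]
  have sub: "block_of v \<tau> \<subseteq> {v..<b}" by (rule block_of_subset[OF t])
  have s1: "B \<subseteq> {a<..<v}" if "B \<in> \<sigma>" for B using nc_on_D(1)[OF s] that by auto
  have t1: "\<not> B \<subseteq> {a<..<v}" "a \<notin> B" if "B \<in> \<tau>" for B
  proof -
    have "B \<subseteq> {v..<b}" "B \<noteq> {}" using nc_on_D(1,3)[OF t] that by auto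
    then obtain x where "x \<in> B" by blast
    moreover from this have "v \<le> x" using \<open>B \<subseteq> {v..<b}\<close> by auto
    ultimately show "\<not> B \<subseteq> {a<..<v}" by auto
    show "a \<notin> B" using \<open>B \<subseteq> {v..<b}\<close> \<open>a < v\<close> by auto
  qed
  show "nc_inner a v (nc_join a v \<sigma> \<tau>) = \<sigma>"
    unfolding nc_inner_def nc_join_def using s1 t1 by auto
  have "{B \<in> nc_join a v \<sigma> \<tau>. a \<notin> B \<and> \<not> B \<subseteq> {a<..<v}} = {B \<in> {B \<in> nc_join a v \<sigma> \<tau>. a \<notin> B}. \<not> B \<subseteq> {a<..<v}}"
    by blast
  also have "\<dots> = {B \<in> \<tau>. v \<notin> B}" unfolding bl(2) using s1 t1 by auto
  finally have 1: "{B \<in> nc_join a v \<sigma> \<tau>. a \<notin> B \<and> \<not> B \<subseteq> {a<..<v}} = {B \<in> \<tau>. v \<notin> B}" .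
  have 2: "insert a (block_of v \<tau>) - {a} = block_of v \<tau>" using sub \<open>a < v\<close> by auto
  have "{B \<in> \<tau>. v \<notin> B} \<union> {block_of v \<tau>} - {{}} = \<tau>"
    using c
  proof
    assume "v < b \<and> block_of v \<tau> \<in> \<tau> \<and> v \<in> block_of v \<tau>"
    moreover have "B = block_of v \<tau>" if "B \<in> \<tau>" "v \<in> B" for B
      using block_of_eq[OF t that] by simp
    ultimately show ?thesis using nc_on_D(3)[OF t] by blast
  qed auto
  thus "nc_outer a v (nc_join a v \<sigma> \<tau>) = \<tau>" unfolding nc_outer_def 1 bl(1) 2 .
qed

section \<open>Recursion for the weighted sums\<close>

lemma nc_sum_rec_aux:
  assumes ab: "a < b"
  shows "nc_sum k j a b = (\<Sum>v\<in>{a<..b}. (\<Sum>\<sigma>\<in>nc_on {a<..<v}. \<Prod>B\<in>\<sigma>. k (card B)) * nc_sum k (Suc j) v b)"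
proof -
  let ?I = "SIGMA v:{a<..b}. nc_on {a<..<v} \<times> nc_on {v..<b}"
  let ?v = "\<lambda>\<pi>. Min (insert b (block_of a \<pi> - {a}))"
  have "(\<Sum>v\<in>{a<..b}. (\<Sum>\<sigma>\<in>nc_on {a<..<v}. \<Prod>B\<in>\<sigma>. k (card B)) * nc_sum k (Suc j) v b) =
     (\<Sum>v\<in>{a<..b}. \<Sum>(\<sigma>, \<tau>)\<in>nc_on {a<..<v} \<times> nc_on {v..<b}. (\<Prod>B\<in>\<sigma>. k (card B)) * nc_weight k (Suc j) v \<tau>)"
    unfolding nc_sum_def sum_product sum.cartesian_product ..
  also have "\<dots> = (\<Sum>(v, \<sigma>, \<tau>)\<in>?I. (\<Prod>B\<in>\<sigma>. k (card B)) * nc_weight k (Suc j) v \<tau>)"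
    by (rule sum.Sigma) (auto intro: finite_nc_on)
  also have "\<dots> = (\<Sum>\<pi>\<in>nc_on {a..<b}. nc_weight k j a \<pi>)"
  proof (rule sum.reindex_bij_witness[where
          i = "\<lambda>\<pi>. (?v \<pi>, nc_inner a (?v \<pi>) \<pi>, nc_outer a (?v \<pi>) \<pi>)" and
          j = "\<lambda>(v, \<sigma>, \<tau>). nc_join a v \<sigma> \<tau>"], goal_cases)
    case (1 x)
    obtain v \<sigma> \<tau> where x: "x = (v, \<sigma>, \<tau>)" by (rule prod_cases3)
    hence *: "a < v" "v \<le> b" "\<sigma> \<in> nc_on {a<..<v}" "\<tau> \<in> nc_on {v..<b}" using 1 by auto
    show ?case by (simp only: x prod.case block_of_nc_join(3)[OF *] nc_split_join[OF *])
  next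
    case (2 x)
    thus ?case by (auto intro: nc_join_mem)
  next
    case (3 \<pi>)
    thus ?case by (simp only: prod.case nc_split(5)[OF _ ab])
  next
    case (4 \<pi>)
    show ?case using nc_split(1-4)[OF 4 ab] by (simp only: mem_Sigma_iff greaterThanAtMost_iff conj_commute)
  next
    case (5 x)
    thus ?case by (auto simp: nc_weight_join)
  qed
  finally show ?thesis by (simp add: nc_sum_def)
qed

text \<open>On an empty interval the weight is \<open>k 0\<close>, while the product over no blocks
  is 1; this is the origin of the convention \<open>k 0 = 1\<close>.\<close>

lemma nc_weight_0:
  assumes "k 0 = 1" "\<pi> \<in> nc_on {a..<b}"
  shows "nc_weight k 0 a \<pi> = (\<Prod>B\<in>\<pi>. k (card B))"
proof (cases "a < b")
  case True
  note bl = block_of_mem[OF assms(2), of a]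
  have "B = block_of a \<pi>" if "B \<in> \<pi>" "a \<in> B" for B
    using block_of_eq[OF assms(2) that] by simp
  hence "\<pi> = insert (block_of a \<pi>) {B\<in>\<pi>. a \<notin> B}" (is "_ = ?S") using True bl(1) by auto
  hence "(\<Prod>B\<in>\<pi>. k (card B)) = (\<Prod>B\<in>?S. k (card B))" by simp
  also have "\<dots> = nc_weight k 0 a \<pi>" unfolding nc_weight_def
    using True bl finite_nc_on_elem[OF _ assms(2)] by (subst prod.insert) auto
  finally show ?thesis by simp
next
  case False
  hence "\<Union>\<pi> = {}" using nc_on_D(1)[OF assms(2)] by simp
  hence "\<pi> = {}" using nc_on_D(3)[OF assms(2)] by auto
  thus ?thesis using assms(1) by (simp add: nc_weight_def block_of_def)
qed

lemma nc_sum_0: "k 0 = 1 \<Longrightarrow> nc_sum k 0 a b = (\<Sum>\<pi>\<in>nc_on {a..<b}. \<Prod>B\<in>\<pi>. k (card B))"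
  unfolding nc_sum_def by (intro sum.cong) (auto simp: nc_weight_0)

lemma nc_sum_rec:
  assumes "k 0 = 1"
  shows "nc_sum k j a (a + Suc n) = (\<Sum>i\<le>n. nc_sum k 0 (Suc a) (Suc a + i) * nc_sum k (Suc j) (Suc a + i) (Suc a + n))"
proof -
  have "nc_sum k j a (a + Suc n) = (\<Sum>v\<in>{a<..a + Suc n}. nc_sum k 0 (Suc a) v * nc_sum k (Suc j) v (a + Suc n))"
    unfolding nc_sum_0[where k = k, OF assms] by (subst nc_sum_rec_aux) (simp_all add: atLeastSucLessThan_greaterThanLessThan)
  also have "\<dots> = (\<Sum>i\<le>n. nc_sum k 0 (Suc a) (Suc a + i) * nc_sum k (Suc j) (Suc a + i) (Suc a + n))"
    by (rule sum.reindex_bij_witness[where i = "\<lambda>i. Suc a + i" and j = "\<lambda>v. v - Suc a"]) auto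
  finally show ?thesis .
qed

lemma nc_sum_empty: "nc_sum k j a a = k j"
proof -
  have "nc_on {} = {{}}" by (auto simp: nc_on_def partition_on_def disjoint_def)
  thus ?thesis by (simp add: nc_sum_def nc_weight_def block_of_def)
qed

text \<open>Translation invariance is read off the recursion, by induction on the length, instead of
  relabelling partitions.\<close>

lemma nc_sum_shift:
  assumes "k 0 = 1"
  shows "nc_sum k j a (a + n) = nc_sum k j 0 n"
proof (induction n arbitrary: a j rule: less_induct)
  case (less n)
  show ?case
  proof (cases n)
    case (Suc m)
    have "nc_sum k j a (a + Suc m) = (\<Sum>i\<le>m. nc_sum k 0 0 i * nc_sum k (Suc j) 0 (m - i))" for a
      unfolding nc_sum_rec[where k = k, OF assms]
    proof (intro sum.cong refl)
      fix i assume "i \<in> {..m}"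
      thus "nc_sum k 0 (Suc a) (Suc a + i) * nc_sum k (Suc j) (Suc a + i) (Suc a + m) =
         nc_sum k 0 0 i * nc_sum k (Suc j) 0 (m - i)"
        using less.IH[of i 0 "Suc a"] less.IH[of "m - i" "Suc j" "Suc a + i"] Suc by simp
    qed
    from this[of a] this[of 0] show ?thesis using Suc by simp
  qed (simp add: nc_sum_empty)
qed

text \<open>Let T_j(z) be the generating function of \<open>nc_sum k j 0 n\<close> in n. Together
  with \<open>nc_sum_empty\<close> this says T_j = k_j + z T_0 T_{j+1}, where T_0 is the moment
  series.\<close>

lemma nc_sum_Suc:
  assumes "k 0 = 1"
  shows "nc_sum k j 0 (Suc n) = (\<Sum>i\<le>n. nc_sum k 0 0 i * nc_sum k (Suc j) 0 (n - i))"
proof -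
  have "nc_sum k j 0 (Suc n) = (\<Sum>i\<le>n. nc_sum k 0 (Suc 0) (Suc 0 + i) * nc_sum k (Suc j) (Suc 0 + i) (Suc 0 + n))"
    using nc_sum_rec[where k = k, OF assms, of j 0 n] by simp
  also have "\<dots> = (\<Sum>i\<le>n. nc_sum k 0 0 i * nc_sum k (Suc j) 0 (n - i))"
  proof (intro sum.cong refl)
    fix i assume "i \<in> {..n}"
    thus "nc_sum k 0 (Suc 0) (Suc 0 + i) * nc_sum k (Suc j) (Suc 0 + i) (Suc 0 + n) =
         nc_sum k 0 0 i * nc_sum k (Suc j) 0 (n - i)"
      using nc_sum_shift[where k = k, OF assms, of 0 "Suc 0" i] nc_sum_shift[where k = k, OF assms, of "Suc j" "Suc 0 + i" "n - i"] by simp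
  qed
  finally show ?thesis .
qed

lemma sum_noncrossing_partitions:
  assumes "k 0 = 1"
  shows "(\<Sum>\<pi>\<in>noncrossing_partitions n. \<Prod>V\<in>\<pi>. k (card V)) = nc_sum k 0 0 n"
proof -
  have "noncrossing_partitions n = nc_on {1..<1 + n}"
    by (simp add: noncrossing_partitions_def nc_on_def atLeastLessThanSuc_atLeastAtMost)
  thus ?thesis using nc_sum_0[where k = k, OF assms, of 1 "1 + n"] nc_sum_shift[where k = k, OF assms, of 0 1 n] by simp
qed

text \<open>This is \<open>M(z) = C(z M(z))\<close> for the truncated series; it follows by iterating \<open>nc_sum_Suc\<close> in \<open>j\<close>.\<close>

lemma moment_cumulant_poly_dvd:
  fixes k :: "nat \<Rightarrow> 'a::comm_ring_1" and p :: nat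
  assumes "k 0 = 1"
  defines "M \<equiv> \<Sum>i\<le>p. monom (\<Sum>\<pi>\<in>noncrossing_partitions i. \<Prod>V\<in>\<pi>. k (card V)) i"
  shows "monom 1 (Suc p) dvd M - (\<Sum>s\<le>p. smult (k s) ((monom 1 1 * M) ^ s))"
proof -
  define t where "t j = (\<Sum>i\<le>p. monom (nc_sum k j 0 i) i)" for j
  define Y where "Y = monom 1 1 * M"
  have M: "M = t 0" unfolding M_def t_def sum_noncrossing_partitions[where k = k, OF assms(1)] ..
  have ct: "coeff (t j) i = (if i \<le> p then nc_sum k j 0 i else 0)" for j i
    by (simp add: t_def coeff_sum)
  \<comment> \<open>The identity T_j = k_j + z T_0 T_{j+1} survives truncation at degree
    \<open>p\<close>, up to multiples of z^(p+1).\<close>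
  have step: "monom 1 (Suc p) dvd t j - ([:k j:] + Y * t (Suc j))" for j
    unfolding monom_1_dvd_iff'
  proof (intro allI impI)
    fix i assume "i < Suc p"
    show "coeff (t j - ([:k j:] + Y * t (Suc j))) i = 0"
    proof (cases i)
      case 0
      have "coeff (Y * t (Suc j)) 0 = 0" by (simp add: Y_def mult.assoc coeff_monom_mult)
      thus ?thesis using 0 by (simp add: ct nc_sum_empty)
    next
      case (Suc n)
      have "coeff (Y * t (Suc j)) i = coeff (monom 1 1 * (M * t (Suc j))) (Suc n)"
        using Suc by (simp add: Y_def mult.assoc)
      also have "\<dots> = (\<Sum>i\<le>n. coeff M i * coeff (t (Suc j)) (n - i))"
        by (subst coeff_monom_mult) (simp add: coeff_mult)
      also have "\<dots> = nc_sum k j 0 (Suc n)"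
        unfolding nc_sum_Suc[where k = k, OF assms(1)] M using \<open>i < Suc p\<close> Suc by (intro sum.cong) (auto simp: ct)
      finally show ?thesis using Suc \<open>i < Suc p\<close> by (simp add: ct)
    qed
  qed
  have iter: "monom 1 (Suc p) dvd M - ((\<Sum>s<j. smult (k s) (Y ^ s)) + Y ^ j * t j)" for j
  proof (induction j)
    case 0 show ?case by (simp add: M)
  next
    case (Suc j)
    have eq: "M - ((\<Sum>s<Suc j. smult (k s) (Y ^ s)) + Y ^ Suc j * t (Suc j)) =
       (M - ((\<Sum>s<j. smult (k s) (Y ^ s)) + Y ^ j * t j)) + Y ^ j * (t j - ([:k j:] + Y * t (Suc j)))"
      by (simp add: algebra_simps)
    show ?case unfolding eq by (intro dvd_add Suc dvd_mult step)
  qed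
  \<comment> \<open>After \<open>p + 1\<close> iterations the remainder carries the factor Y^(p+1),
    and Y = z M is a multiple of z.\<close>
  have "Y ^ Suc p * t (Suc p) = monom 1 (Suc p) * (M ^ Suc p * t (Suc p))"
    by (simp add: Y_def power_mult_distrib monom_power mult.assoc del: power_Suc)
  hence "monom 1 (Suc p) dvd Y ^ Suc p * t (Suc p)" by simp
  from dvd_add[OF iter[of "Suc p"] this] show ?thesis by (simp add: Y_def lessThan_Suc_atMost)
qed


section \<open>The Cauchy transform near infinity\<close>

lemma bigo_1_poly:
  fixes u :: "'b \<Rightarrow> 'a::real_normed_field"
  assumes "u \<in> O[F](\<lambda>_. 1)"
  shows "(\<lambda>x. poly P (u x)) \<in> O[F](\<lambda>_. 1)"
proof (induction P)
  case (pCons a P)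
  have "(\<lambda>x. u x * poly P (u x)) \<in> O[F](\<lambda>x. 1 * 1)"
    by (rule landau_o.big.mult[OF assms pCons.IH])
  thus ?case by (auto intro!: sum_in_bigo)
qed simp

text \<open>Polynomials are Lipschitz on bounded sets; in Horner form, u P(u) - v P(v) = u (P(u) -
  P(v)) + (u - v) P(v).\<close>

lemma bigo_poly_diff:
  fixes u v :: "'b \<Rightarrow> 'a::real_normed_field"
  assumes u: "u \<in> O[F](\<lambda>_. 1)" and v: "v \<in> O[F](\<lambda>_. 1)"
  shows "(\<lambda>x. poly P (u x) - poly P (v x)) \<in> O[F](\<lambda>x. u x - v x)"
proof (induction P)
  case (pCons a P)
  have "(\<lambda>x. u x * (poly P (u x) - poly P (v x))) \<in> O[F](\<lambda>x. 1 * (u x - v x))"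
    by (rule landau_o.big.mult[OF u pCons.IH])
  moreover have "(\<lambda>x. (u x - v x) * poly P (v x)) \<in> O[F](\<lambda>x. (u x - v x) * 1)"
    by (rule landau_o.big.mult[OF landau_o.big_refl bigo_1_poly[OF v]])
  ultimately have "(\<lambda>x. u x * (poly P (u x) - poly P (v x)) + (u x - v x) * poly P (v x)) \<in> O[F](\<lambda>x. u x - v x)"
    by (auto intro: sum_in_bigo)
  thus ?case by (simp add: algebra_simps)
qed simp

text \<open>Dominated convergence for a continuous parameter, by testing along sequences in
  \<open>S\<close>.\<close>

lemma tendsto_integral_at_within:
  fixes F :: "'c::metric_space \<Rightarrow> 'a \<Rightarrow> 'b::{banach, second_countable_topology}"
  assumes w: "integrable M w"
    and F: "\<And>z. z \<in> S \<Longrightarrow> F z \<in> borel_measurable M" and G: "G \<in> borel_measurable M"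
    and bd: "\<And>z t. z \<in> S \<Longrightarrow> norm (F z t) \<le> w t"
    and lim: "\<And>t. ((\<lambda>z. F z t) \<longlongrightarrow> G t) (at z0 within S)"
  shows "((\<lambda>z. \<integral>t. F z t \<partial>M) \<longlongrightarrow> (\<integral>t. G t \<partial>M)) (at z0 within S)"
  unfolding tendsto_at_iff_sequentially
proof (intro allI impI)
  fix X :: "nat \<Rightarrow> 'c" assume X: "\<forall>i. X i \<in> S - {z0}" "X \<longlonglongrightarrow> z0"
  have "(\<lambda>i. \<integral>t. F (X i) t \<partial>M) \<longlonglongrightarrow> (\<integral>t. G t \<partial>M)"
  proof (rule integral_dominated_convergence[where w = w])
    show "AE t in M. (\<lambda>i. F (X i) t) \<longlonglongrightarrow> G t"
      using lim X by (intro AE_I2) (auto simp: tendsto_at_iff_sequentially o_def)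
  qed (use X F G bd w in auto)
  thus "((\<lambda>z. \<integral>t. F z t \<partial>M) \<circ> X) \<longlonglongrightarrow> (\<integral>t. G t \<partial>M)" by (simp add: o_def)
qed

section \<open>Geometry of truncated cones\<close>

lemma open_trunc_cone: "open (trunc_cone \<alpha> \<beta>)"
proof -
  have "trunc_cone \<alpha> \<beta> = {z. \<bar>Re z\<bar> < - \<alpha> * Im z} \<inter> {z. cmod z < \<beta>}" by (auto simp: trunc_cone_def)
  also have "open \<dots>" by (intro open_Int open_Collect_less continuous_intros)
  finally show ?thesis .
qed

lemma convex_trunc_cone: "convex (trunc_cone \<alpha> \<beta>)"
proof -
  have "convex {z. \<bar>Re z\<bar> < - \<alpha> * Im z}"
  proof -
    have "{z. \<bar>Re z\<bar> < - \<alpha> * Im z} = {z. inner (Complex 1 \<alpha>) z < 0} \<inter> {z. inner (Complex (-1) \<alpha>) z < 0}"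
      by (auto simp: inner_complex_def)
    thus ?thesis by (simp add: convex_Int convex_halfspace_lt)
  qed
  moreover have "trunc_cone \<alpha> \<beta> = {z. \<bar>Re z\<bar> < - \<alpha> * Im z} \<inter> ball 0 \<beta>"
    by (auto simp: trunc_cone_def)
  ultimately show ?thesis by (simp add: convex_Int)
qed

lemma minus_ii_in_trunc_cone: "\<alpha> > 0 \<Longrightarrow> 0 < y \<Longrightarrow> y < \<beta> \<Longrightarrow> - \<i> * complex_of_real y \<in> trunc_cone \<alpha> \<beta>"
  by (simp add: trunc_cone_def norm_mult)

text \<open>Turns estimates on cones into statements about single points of the lower half-plane.
  Adding 1 to the ratio makes the slope positive and the inequality strict.\<close>

lemma ex_trunc_cone:
  assumes "Im z < 0"
  obtains \<alpha> \<beta> where "\<alpha> > 0" "z \<in> trunc_cone \<alpha> \<beta>"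
proof
  show "\<bar>Re z\<bar> / (- Im z) + 1 > 0" using assms by (intro add_nonneg_pos divide_nonneg_pos) auto
  have "- (\<bar>Re z\<bar> / (- Im z) + 1) * Im z = \<bar>Re z\<bar> - Im z"
    using assms by (simp add: field_simps)
  thus "z \<in> trunc_cone (\<bar>Re z\<bar> / (- Im z) + 1) (cmod z + 1)"
    using assms by (simp add: trunc_cone_def)
qed

text \<open>Origin of the constant: with y = -Im w the cone gives |w| <= (\<alpha> + 1) y, so the
  perturbation is at most \<epsilon> = y / (\<alpha> + 2). The real part may then grow to \<alpha> y
  + \<epsilon> and the height shrink to y - \<epsilon>, and (\<alpha> + 1) (y - \<epsilon>) =
  \<alpha> y + \<epsilon> holds exactly for this \<epsilon>.\<close>

lemma trunc_cone_perturb: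
  assumes \<alpha>: "\<alpha> > 0" and w: "w \<in> trunc_cone \<alpha> \<beta>"
    and d: "cmod (z - w) \<le> cmod w / ((\<alpha> + 1) * (\<alpha> + 2))"
  shows "z \<in> trunc_cone (\<alpha> + 1) (2 * \<beta>)" "cmod z \<le> 2 * cmod w"
proof -
  define y where "y = - Im w"
  have y: "y > 0" using trunc_cone_Im_neg[OF \<alpha> w] by (simp add: y_def)
  have rw: "\<bar>Re w\<bar> < \<alpha> * y" "cmod w < \<beta>" using w by (auto simp: trunc_cone_def y_def)
  have "cmod w \<le> \<bar>Re w\<bar> + \<bar>Im w\<bar>" by (rule cmod_le)
  also have "\<dots> \<le> (\<alpha> + 1) * y" using rw y by (simp add: y_def algebra_simps)
  finally have "cmod w / ((\<alpha> + 1) * (\<alpha> + 2)) \<le> ((\<alpha> + 1) * y) / ((\<alpha> + 1) * (\<alpha> + 2))"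
    using \<alpha> by (intro divide_right_mono) auto
  also have "\<dots> = y / (\<alpha> + 2)" using \<alpha> by simp
  finally have e: "cmod (z - w) \<le> y / (\<alpha> + 2)" using d by simp
  define \<epsilon> where "\<epsilon> = y / (\<alpha> + 2)"
  have \<epsilon>: "\<epsilon> * (\<alpha> + 2) = y" using \<alpha> by (simp add: \<epsilon>_def)
  have "\<bar>Re z - Re w\<bar> \<le> \<epsilon>" "\<bar>Im z - Im w\<bar> \<le> \<epsilon>"
    using abs_Re_le_cmod[of "z - w"] abs_Im_le_cmod[of "z - w"] e by (auto simp: \<epsilon>_def)
  hence "\<bar>Re z\<bar> < \<alpha> * y + \<epsilon>" "- Im z \<ge> y - \<epsilon>" using rw by (auto simp: y_def)
  moreover have "(\<alpha> + 1) * (- Im z) \<ge> (\<alpha> + 1) * (y - \<epsilon>)"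
    using calculation \<alpha> by (intro mult_left_mono) auto
  moreover have "(\<alpha> + 1) * (y - \<epsilon>) = \<alpha> * y + \<epsilon>"
    using \<epsilon> by (simp add: algebra_simps)
  ultimately have re: "\<bar>Re z\<bar> < - (\<alpha> + 1) * Im z" by (simp add: algebra_simps)
  have "1 * 2 \<le> (\<alpha> + 1) * (\<alpha> + 2)" using \<alpha> by (intro mult_mono) auto
  hence "cmod w / ((\<alpha> + 1) * (\<alpha> + 2)) \<le> cmod w / 2" by (intro divide_left_mono) auto
  hence zw: "cmod (z - w) \<le> cmod w / 2" by (rule order_trans[OF d])
  show le: "cmod z \<le> 2 * cmod w" using zw norm_triangle_ineq2[of z w] norm_ge_zero[of w] by linarith
  show "z \<in> trunc_cone (\<alpha> + 1) (2 * \<beta>)" using re le rw by (simp add: trunc_cone_def)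
qed

lemma trunc_cone_resolvent_bound':
  assumes "\<alpha> > 0" "z \<in> trunc_cone \<alpha> \<beta>"
  shows "cmod (z * complex_of_real t / (1 - z * complex_of_real t)) \<le> 2 + \<alpha>"
proof -
  have "z * complex_of_real t / (1 - z * complex_of_real t) = 1 / (1 - z * complex_of_real t) - 1"
    using trunc_cone_resolvent_bound(2)[OF assms, of t] by (simp add: field_simps)
  thus ?thesis
    using trunc_cone_resolvent_bound(1)[OF assms, of t] norm_triangle_ineq4[of "1 / (1 - z * complex_of_real t)" 1]
    by simp
qed

section \<open>Resolvent integrals: expansion and holomorphy\<close>

context real_distribution
begin

text \<open>\<open>res_int 0\<close> is the function h of the overview;
  \<open>res_int (Suc n)\<close> is the factor of z^(n+1) in the remainder of its expansion of order
  \<open>n\<close>.\<close>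

definition res_int :: "nat \<Rightarrow> complex \<Rightarrow> complex"
  where "res_int n z = (\<integral>t. complex_of_real t ^ n / (1 - z * complex_of_real t) \<partial>M)"

lemma cauchy_recip_eq: "Im z < 0 \<Longrightarrow> cauchy_recip z = z * res_int 0 z"
proof -
  assume "Im z < 0"
  hence z: "z \<noteq> 0" by auto
  have "cauchy_recip z = (\<integral>t. z * (1 / (1 - z * complex_of_real t)) \<partial>M)"
    unfolding cauchy_transform_def
  proof (rule Bochner_Integration.integral_cong[OF refl])
    fix t
    have "1 / z - complex_of_real t = (1 - z * complex_of_real t) / z" using z by (simp add: field_simps)
    thus "1 / (1 / z - complex_of_real t) = z * (1 / (1 - z * complex_of_real t))" by simp
  qed
  thus ?thesis unfolding integral_mult_right_zero by (simp add: res_int_def)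
qed

lemma has_moment_integrable: "has_moment M n \<longleftrightarrow> integrable M (\<lambda>t. t ^ n)"
  unfolding has_moment_def using integrable_abs_iff[of "\<lambda>t. t ^ n" M] by (simp add: power_abs)

lemma has_moment_mono:
  assumes "has_moment M n" "m \<le> n"
  shows "has_moment M m"
  unfolding has_moment_def
proof (rule Bochner_Integration.integrable_bound)
  show "integrable M (\<lambda>t. 1 + \<bar>t\<bar> ^ n)" using assms(1) by (simp add: has_moment_def)
  show "AE t in M. norm (\<bar>t\<bar> ^ m) \<le> norm (1 + \<bar>t\<bar> ^ n)"
  proof (rule AE_I2)
    fix t :: real
    have "\<bar>t\<bar> ^ m \<le> 1 + \<bar>t\<bar> ^ n"
    proof (cases "\<bar>t\<bar> \<le> 1")
      case True
      hence "\<bar>t\<bar> ^ m \<le> 1" by (simp add: power_le_one)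
      thus ?thesis by (simp add: add_increasing2)
    next
      case False
      hence "\<bar>t\<bar> ^ m \<le> \<bar>t\<bar> ^ n" using assms(2) by (intro power_increasing) auto
      thus ?thesis by simp
    qed
    thus "norm (\<bar>t\<bar> ^ m) \<le> norm (1 + \<bar>t\<bar> ^ n)" by simp
  qed
qed auto

text \<open>In the second part one power of t more than the moment allows is paid for by the
  resolvent: zt/(1 - zt) is bounded on a cone, at the price of a factor 1/|z|.\<close>

lemma integrable_res_int:
  assumes n: "has_moment M n" and z: "Im z < 0"
  shows "integrable M (\<lambda>t. complex_of_real t ^ n / (1 - z * complex_of_real t))"
    and "integrable M (\<lambda>t. complex_of_real t ^ Suc n / (1 - z * complex_of_real t))"
proof -
  obtain \<alpha> \<beta> where c: "\<alpha> > 0" "z \<in> trunc_cone \<alpha> \<beta>" using ex_trunc_cone[OF z] .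
  show "integrable M (\<lambda>t. complex_of_real t ^ n / (1 - z * complex_of_real t))"
  proof (rule Bochner_Integration.integrable_bound)
    show "integrable M (\<lambda>t. (1 + \<alpha>) * \<bar>t\<bar> ^ n)" using n by (simp add: has_moment_def)
    show "AE t in M. norm (complex_of_real t ^ n / (1 - z * complex_of_real t)) \<le> norm ((1 + \<alpha>) * \<bar>t\<bar> ^ n)"
    proof (rule AE_I2)
      fix t
      show "norm (complex_of_real t ^ n / (1 - z * complex_of_real t)) \<le> norm ((1 + \<alpha>) * \<bar>t\<bar> ^ n)"
        using mult_right_mono[OF trunc_cone_resolvent_bound(1)[OF c, of t], of "\<bar>t\<bar> ^ n"] c(1)
        by (simp add: norm_divide norm_power norm_mult)
    qed
  qed auto
  show "integrable M (\<lambda>t. complex_of_real t ^ Suc n / (1 - z * complex_of_real t))"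
  proof (rule Bochner_Integration.integrable_bound)
    show "integrable M (\<lambda>t. (2 + \<alpha>) / cmod z * \<bar>t\<bar> ^ n)" using n by (simp add: has_moment_def)
    show "AE t in M. norm (complex_of_real t ^ Suc n / (1 - z * complex_of_real t)) \<le> norm ((2 + \<alpha>) / cmod z * \<bar>t\<bar> ^ n)"
    proof (rule AE_I2)
      fix t
      show "norm (complex_of_real t ^ Suc n / (1 - z * complex_of_real t)) \<le> norm ((2 + \<alpha>) / cmod z * \<bar>t\<bar> ^ n)"
      proof -
        have "z \<noteq> 0" using z by auto
        hence "norm (complex_of_real t ^ Suc n / (1 - z * complex_of_real t)) =
            cmod (z * complex_of_real t / (1 - z * complex_of_real t)) * \<bar>t\<bar> ^ n / cmod z"
          by (simp add: norm_divide norm_power norm_mult)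
        also have "\<dots> \<le> (2 + \<alpha>) * \<bar>t\<bar> ^ n / cmod z"
          by (intro divide_right_mono mult_right_mono trunc_cone_resolvent_bound'[OF c]) auto
        finally show ?thesis using c(1) by simp
      qed
    qed
  qed auto
qed

text \<open>The integrand is t^n times zt/(1 - zt), which is bounded on the cone and tends to 0
  pointwise. In \<open>res_int_expand\<close> this makes the remainder o(z^n) from a moment of order
  \<open>n\<close> only.\<close>

lemma tendsto_mult_res_int:
  assumes n: "has_moment M n" and \<alpha>: "\<alpha> > 0"
  shows "((\<lambda>z. z * res_int (Suc n) z) \<longlongrightarrow> 0) (at 0 within trunc_cone \<alpha> \<beta>)"
proof -
  have "((\<lambda>z. \<integral>t. complex_of_real t ^ n * (z * complex_of_real t / (1 - z * complex_of_real t)) \<partial>M) \<longlongrightarrow>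
      (\<integral>t. 0 \<partial>M)) (at 0 within trunc_cone \<alpha> \<beta>)"
  proof (rule tendsto_integral_at_within)
    show "integrable M (\<lambda>t. \<bar>t\<bar> ^ n * (2 + \<alpha>))" using n by (simp add: has_moment_def)
    show "norm (complex_of_real t ^ n * (z * complex_of_real t / (1 - z * complex_of_real t))) \<le> \<bar>t\<bar> ^ n * (2 + \<alpha>)"
      if "z \<in> trunc_cone \<alpha> \<beta>" for z t
      unfolding norm_mult norm_power using trunc_cone_resolvent_bound'[OF \<alpha> that, of t]
      by (intro mult_mono) (auto simp: norm_mult)
    show "((\<lambda>z. complex_of_real t ^ n * (z * complex_of_real t / (1 - z * complex_of_real t))) \<longlongrightarrow> 0)
        (at 0 within trunc_cone \<alpha> \<beta>)" for t
      by (rule tendsto_eq_rhs, (rule tendsto_intros)+) auto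
  qed auto
  moreover have "(\<integral>t. complex_of_real t ^ n * (z * complex_of_real t / (1 - z * complex_of_real t)) \<partial>M) = z * res_int (Suc n) z" for z
    unfolding res_int_def by (subst integral_mult_right_zero[symmetric]) (simp add: mult_ac)
  ultimately show ?thesis by simp
qed

text \<open>Integrates the finite geometric sum 1/(1 - x) = 1 + x + ... + x^n + x^(n+1)/(1 - x) at x
  = zt.\<close>

lemma res_int_expand:
  assumes n: "has_moment M n" and z: "Im z < 0"
  shows "res_int 0 z = (\<Sum>i\<le>n. complex_of_real (moment M i) * z ^ i) + z ^ Suc n * res_int (Suc n) z"
proof -
  have nz: "1 - z * complex_of_real t \<noteq> 0" for t
    using ex_trunc_cone[OF z] trunc_cone_resolvent_bound(2) by metis
  have i: "integrable M (\<lambda>t. complex_of_real t ^ i)" if "i \<le> n" for i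
  proof -
    have "integrable M (\<lambda>t. complex_of_real (t ^ i))"
      using has_moment_mono[OF n that] unfolding has_moment_integrable by (rule integrable_of_real)
    thus ?thesis by simp
  qed
  have "res_int 0 z = (\<integral>t. (\<Sum>i\<le>n. complex_of_real t ^ i * z ^ i) + z ^ Suc n * (complex_of_real t ^ Suc n / (1 - z * complex_of_real t)) \<partial>M)"
    unfolding res_int_def
  proof (rule Bochner_Integration.integral_cong[OF refl])
    fix t
    define x where "x = z * complex_of_real t"
    have "(1 - x) * (\<Sum>i\<le>n. x ^ i) = 1 - x ^ Suc n"
      by (simp only: sum_gp_basic)
    hence "(\<Sum>i\<le>n. x ^ i) + x ^ Suc n / (1 - x) = 1 / (1 - x)"
      using nz[of t] by (simp add: x_def[symmetric] field_simps)
    moreover have "(\<Sum>i\<le>n. complex_of_real t ^ i * z ^ i) = (\<Sum>i\<le>n. x ^ i)"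
      by (intro sum.cong) (simp_all add: x_def power_mult_distrib)
    moreover have "z ^ Suc n * (complex_of_real t ^ Suc n / (1 - z * complex_of_real t)) = x ^ Suc n / (1 - x)"
      by (simp add: x_def power_mult_distrib del: power_Suc)
    moreover have "complex_of_real t ^ 0 / (1 - z * complex_of_real t) = 1 / (1 - x)" by (simp add: x_def)
    ultimately show "complex_of_real t ^ 0 / (1 - z * complex_of_real t) =
      (\<Sum>i\<le>n. complex_of_real t ^ i * z ^ i) + z ^ Suc n * (complex_of_real t ^ Suc n / (1 - z * complex_of_real t))"
      by (simp only:)
  qed
  also have "\<dots> = (\<integral>t. (\<Sum>i\<le>n. complex_of_real t ^ i * z ^ i) \<partial>M) + z ^ Suc n * res_int (Suc n) z"
    unfolding res_int_def using integrable_res_int[OF n z] i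
    by (subst Bochner_Integration.integral_add) (auto simp del: power_Suc times_divide_eq_right)
  also have "(\<integral>t. (\<Sum>i\<le>n. complex_of_real t ^ i * z ^ i) \<partial>M) = (\<Sum>i\<le>n. (\<integral>t. complex_of_real t ^ i \<partial>M) * z ^ i)"
    using i by (subst Bochner_Integration.integral_sum) auto
  also have "(\<Sum>i\<le>n. (\<integral>t. complex_of_real t ^ i \<partial>M) * z ^ i) =
      (\<Sum>i\<le>n. complex_of_real (moment M i) * z ^ i)"
    unfolding moment_def by (simp flip: of_real_power)
  finally show ?thesis .
qed

lemma has_moment_0: "has_moment M 0"
  by (simp add: has_moment_def)

lemma moment_0: "moment M 0 = 1"
  using prob_space by (simp add: moment_def)

lemma tendsto_res_int_0:
  assumes \<alpha>: "\<alpha> > 0"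
  shows "(res_int 0 \<longlongrightarrow> 1) (at 0 within trunc_cone \<alpha> \<beta>)"
proof -
  have "((\<lambda>z. 1 + z * res_int (Suc 0) z) \<longlongrightarrow> 1 + 0) (at 0 within trunc_cone \<alpha> \<beta>)"
    by (intro tendsto_intros tendsto_mult_res_int[OF has_moment_0 \<alpha>])
  moreover have "res_int 0 z = 1 + z * res_int (Suc 0) z" if "z \<in> trunc_cone \<alpha> \<beta>" for z
    using res_int_expand[OF has_moment_0, of z] trunc_cone_Im_neg[OF \<alpha> that] by (simp add: moment_0)
  ultimately show ?thesis
    by (subst tendsto_cong[where g = "\<lambda>z. 1 + z * res_int (Suc 0) z"]) (auto simp: eventually_at_filter)
qed

text \<open>The resolvent identity u_w - u_z = (w - z) t u_w u_z turns the difference quotient into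
  one integral. Its factor t is absorbed by u_z, since t u_z is bounded for fixed z, so the limit w
  -> z can be taken under the integral.\<close>

lemma res_int_0_holomorphic:
  assumes \<alpha>: "\<alpha> > 0"
  shows "res_int 0 holomorphic_on trunc_cone \<alpha> \<beta>"
proof (rule holomorphic_onI)
  fix z assume z: "z \<in> trunc_cone \<alpha> \<beta>"
  define u where "u z t = 1 / (1 - z * complex_of_real t)" for z t
  note nz = trunc_cone_resolvent_bound(2)[OF \<alpha>]
  have ub: "cmod (u w t) \<le> 1 + \<alpha>" if "w \<in> trunc_cone \<alpha> \<beta>" for w t
    using trunc_cone_resolvent_bound(1)[OF \<alpha> that] by (simp add: u_def)
  have um [measurable]: "u w \<in> borel_measurable M" for w unfolding u_def by measurable
  have ui: "integrable M (u w)" if "w \<in> trunc_cone \<alpha> \<beta>" for w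
    using integrable_res_int(1)[OF has_moment_0 trunc_cone_Im_neg[OF \<alpha> that]] by (simp add: u_def[abs_def])
  have "((\<lambda>w. \<integral>t. complex_of_real t * u w t * u z t \<partial>M) \<longlongrightarrow> (\<integral>t. complex_of_real t * u z t * u z t \<partial>M)) (at z within trunc_cone \<alpha> \<beta>)"
  proof (rule tendsto_integral_at_within)
    have "z \<noteq> 0" using trunc_cone_Im_neg[OF \<alpha> z] by auto
    have tz: "cmod (complex_of_real t * u z t) \<le> (2 + \<alpha>) / cmod z" for t
      using trunc_cone_resolvent_bound'[OF \<alpha> z, of t] \<open>z \<noteq> 0\<close>
      by (simp add: u_def norm_mult norm_divide field_simps)
    show "integrable M (\<lambda>t. (1 + \<alpha>) * ((2 + \<alpha>) / cmod z))" by simp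
    show "norm (complex_of_real t * u w t * u z t) \<le> (1 + \<alpha>) * ((2 + \<alpha>) / cmod z)"
      if "w \<in> trunc_cone \<alpha> \<beta>" for w t
    proof -
      have "complex_of_real t * u w t * u z t = u w t * (complex_of_real t * u z t)" by (simp add: mult_ac)
      hence "norm (complex_of_real t * u w t * u z t) = norm (u w t) * norm (complex_of_real t * u z t)"
        by (simp only: norm_mult)
      also have "\<dots> \<le> (1 + \<alpha>) * ((2 + \<alpha>) / cmod z)" using ub[OF that, of t] tz[of t] \<alpha> by (intro mult_mono) auto
      finally show ?thesis .
    qed
    show "((\<lambda>w. complex_of_real t * u w t * u z t) \<longlongrightarrow> complex_of_real t * u z t * u z t) (at z within trunc_cone \<alpha> \<beta>)" for t
      unfolding u_def using nz[OF z, of t] by (intro tendsto_intros) auto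
  qed auto
  moreover have "(res_int 0 w - res_int 0 z) / (w - z) = (\<integral>t. complex_of_real t * u w t * u z t \<partial>M)"
    if w: "w \<in> trunc_cone \<alpha> \<beta>" "w \<noteq> z" for w
  proof -
    have "res_int 0 w - res_int 0 z = (\<integral>t. u w t - u z t \<partial>M)"
      using Bochner_Integration.integral_diff[OF ui[OF w(1)] ui[OF z]]
      by (simp add: res_int_def u_def[abs_def])
    also have "\<dots> = (\<integral>t. (w - z) * (complex_of_real t * u w t * u z t) \<partial>M)"
    proof (rule Bochner_Integration.integral_cong[OF refl])
      fix t show "u w t - u z t = (w - z) * (complex_of_real t * u w t * u z t)"
        using nz[OF z, of t] nz[OF w(1), of t] by (simp add: u_def field_simps)
    qed
    finally show ?thesis using w by simp
  qed
  ultimately have "((\<lambda>w. (res_int 0 w - res_int 0 z) / (w - z)) \<longlongrightarrow> (\<integral>t. complex_of_real t * u z t * u z t \<partial>M)) (at z within trunc_cone \<alpha> \<beta>)"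
    by (subst tendsto_cong[where g = "\<lambda>w. \<integral>t. complex_of_real t * u w t * u z t \<partial>M"]) (auto simp: eventually_at_filter)
  thus "res_int 0 field_differentiable at z within trunc_cone \<alpha> \<beta>"
    unfolding field_differentiable_def has_field_derivative_iff by blast
qed

section \<open>Mapping properties of z -> G(1/z)\<close>

lemma cauchy_recip_holomorphic:
  assumes \<alpha>: "\<alpha> > 0"
  shows "cauchy_recip holomorphic_on trunc_cone \<alpha> \<beta>"
proof -
  have "(\<lambda>z. z * res_int 0 z) holomorphic_on trunc_cone \<alpha> \<beta>"
    by (intro holomorphic_intros res_int_0_holomorphic[OF \<alpha>])
  thus ?thesis
    by (rule holomorphic_transform) (simp add: cauchy_recip_eq trunc_cone_Im_neg[OF \<alpha>])
qed

text \<open>The Cauchy transform maps the upper half-plane into the open lower one: its imaginary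
  part is the integral of a strictly negative function.\<close>

lemma cauchy_recip_nonzero:
  assumes z: "Im z < 0"
  shows "cauchy_recip z \<noteq> 0"
proof -
  define \<zeta> where "\<zeta> = 1 / z"
  have "(Re z)\<^sup>2 + (Im z)\<^sup>2 > 0" using z by (simp add: sum_power2_gt_zero_iff)
  hence \<zeta>: "Im \<zeta> > 0" using z by (simp add: \<zeta>_def Im_divide divide_neg_pos)
  have nz: "\<zeta> - complex_of_real t \<noteq> 0" for t using \<zeta> by (auto simp: complex_eq_iff)
  have int: "integrable M (\<lambda>t. 1 / (\<zeta> - complex_of_real t))"
  proof (rule integrable_const_bound[where B = "1 / Im \<zeta>"])
    show "AE t in M. norm (1 / (\<zeta> - complex_of_real t)) \<le> 1 / Im \<zeta>"
    proof (rule AE_I2)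
      fix t
      have "Im \<zeta> \<le> cmod (\<zeta> - complex_of_real t)" using abs_Im_le_cmod[of "\<zeta> - complex_of_real t"] by simp
      thus "norm (1 / (\<zeta> - complex_of_real t)) \<le> 1 / Im \<zeta>" using \<zeta> by (simp add: norm_divide frac_le)
    qed
  qed measurable
  have "Im (cauchy_recip z) = (\<integral>t. Im (1 / (\<zeta> - complex_of_real t)) \<partial>M)"
    unfolding cauchy_transform_def \<zeta>_def[symmetric] by (rule integral_Im[OF int, symmetric])
  also have "\<dots> < (\<integral>t. 0 \<partial>M)"
  proof (rule integral_less_AE_space)
    show "integrable M (\<lambda>t. Im (1 / (\<zeta> - complex_of_real t)))" using int by (rule integrable_Im)
    show "AE t in M. Im (1 / (\<zeta> - complex_of_real t)) < 0"
    proof (rule AE_I2)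
      fix t
      have "(Re (\<zeta> - complex_of_real t))\<^sup>2 + (Im \<zeta>)\<^sup>2 > 0" using \<zeta> by (simp add: add_nonneg_pos)
      thus "Im (1 / (\<zeta> - complex_of_real t)) < 0" using \<zeta> by (simp add: Im_divide divide_neg_pos)
    qed
    show "emeasure M (space M) \<noteq> 0" using emeasure_space_1 by simp
  qed auto
  finally show ?thesis by auto
qed

lemma cauchy_recip_close:
  assumes \<alpha>: "\<alpha> > 0" and \<eta>: "\<eta> > 0"
  obtains \<gamma> where "\<gamma> > 0" "\<And>z. z \<in> trunc_cone \<alpha> \<gamma> \<Longrightarrow> cmod (cauchy_recip z - z) \<le> \<eta> * cmod z"
proof -
  have "\<forall>\<^sub>F z in at 0 within trunc_cone \<alpha> 1. dist (res_int 0 z) 1 < \<eta>"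
    by (rule tendstoD[OF tendsto_res_int_0[OF \<alpha>] \<eta>])
  then obtain d where d: "d > 0" "\<And>z. z \<in> trunc_cone \<alpha> 1 \<Longrightarrow> z \<noteq> 0 \<Longrightarrow> dist z 0 < d \<Longrightarrow> dist (res_int 0 z) 1 < \<eta>"
    unfolding eventually_at by blast
  show ?thesis
  proof (rule that[of "min d 1"])
    fix z assume z: "z \<in> trunc_cone \<alpha> (min d 1)"
    have im: "Im z < 0" by (rule trunc_cone_Im_neg[OF \<alpha> z])
    hence "z \<noteq> 0" by auto
    hence "cmod (res_int 0 z - 1) < \<eta>" using d(2)[of z] z by (auto simp: trunc_cone_def dist_norm)
    moreover have "cauchy_recip z - z = (res_int 0 z - 1) * z" using cauchy_recip_eq[OF im] by (simp add: algebra_simps)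
    ultimately show "cmod (cauchy_recip z - z) \<le> \<eta> * cmod z" by (simp add: norm_mult mult_right_mono)
  qed (use d in auto)
qed

text \<open>Preimages come from Brouwer: a fixed point of z -> w + z - G(1/z) solves G(1/z) = w. The
  map sends the ball of radius \<open>\<eta>\<close> |w| around w to itself because G(1/z) is close
  to z. This covering is what carries statements in z over to w.\<close>

lemma cauchy_recip_covers:
  assumes \<alpha>: "\<alpha> > 0" and \<gamma>: "\<gamma> > 0"
  obtains \<beta> where "\<beta> > 0"
    "\<And>w. w \<in> trunc_cone \<alpha> \<beta> \<Longrightarrow> \<exists>z\<in>trunc_cone (\<alpha> + 1) \<gamma>. cauchy_recip z = w"
proof -
  \<comment> \<open>The relative radius allowed by \<open>trunc_cone_perturb\<close>. Below,
    closeness is demanded with half of it to make up for |z| <= 2 |w| on the ball.\<close>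
  define \<eta> where "\<eta> = 1 / ((\<alpha> + 1) * (\<alpha> + 2))"
  have \<eta>: "\<eta> > 0" using \<alpha> by (simp add: \<eta>_def)
  obtain \<gamma>' where \<gamma>': "\<gamma>' > 0" "\<And>z. z \<in> trunc_cone (\<alpha> + 1) \<gamma>' \<Longrightarrow> cmod (cauchy_recip z - z) \<le> \<eta> / 2 * cmod z"
    using cauchy_recip_close[of "\<alpha> + 1" "\<eta> / 2"] \<alpha> \<eta> by auto
  show ?thesis
  proof (rule that[of "min \<gamma> \<gamma>' / 2"])
    show "min \<gamma> \<gamma>' / 2 > 0" using \<gamma> \<gamma>' by simp
    fix w assume w: "w \<in> trunc_cone \<alpha> (min \<gamma> \<gamma>' / 2)"
    have w0: "w \<noteq> 0" using trunc_cone_Im_neg[OF \<alpha> w] by auto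
    have ball: "z \<in> trunc_cone (\<alpha> + 1) (min \<gamma> \<gamma>')" "cmod z \<le> 2 * cmod w" if "z \<in> cball w (\<eta> * cmod w)" for z
      using trunc_cone_perturb[OF \<alpha> w, of z] that by (auto simp: \<eta>_def dist_norm norm_minus_commute)
    have sub: "cball w (\<eta> * cmod w) \<subseteq> trunc_cone (\<alpha> + 1) (min \<gamma> \<gamma>')" using ball by blast
    have "continuous_on (cball w (\<eta> * cmod w)) (\<lambda>z. w + z - cauchy_recip z)"
      using \<alpha> by (intro continuous_intros continuous_on_subset[OF holomorphic_on_imp_continuous_on[OF cauchy_recip_holomorphic] sub]) auto
    moreover have "w + z - cauchy_recip z \<in> cball w (\<eta> * cmod w)" if z: "z \<in> cball w (\<eta> * cmod w)" for z
    proof -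
      have "z \<in> trunc_cone (\<alpha> + 1) \<gamma>'"
        using ball(1)[OF z] by (auto simp: trunc_cone_def)
      hence "cmod (cauchy_recip z - z) \<le> \<eta> / 2 * cmod z" by (rule \<gamma>'(2))
      also have "\<dots> \<le> \<eta> / 2 * (2 * cmod w)" using \<eta> ball(2)[OF z] by (intro mult_left_mono) auto
      finally show ?thesis by (simp add: dist_norm)
    qed
    ultimately obtain z where z: "z \<in> cball w (\<eta> * cmod w)" "w + z - cauchy_recip z = z"
      using brouwer_ball[of "\<eta> * cmod w" w "\<lambda>z. w + z - cauchy_recip z"] \<eta> w0 by auto
    have "cauchy_recip z = w" using z(2) by (simp add: algebra_simps)
    moreover have "z \<in> trunc_cone (\<alpha> + 1) \<gamma>" using ball(1)[OF z(1)] by (auto simp: trunc_cone_def)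
    ultimately show "\<exists>z\<in>trunc_cone (\<alpha> + 1) \<gamma>. cauchy_recip z = w" by blast
  qed
qed

end


section \<open>Non-tangential expansions\<close>

text \<open>The filter depends on the slope only; the radius 1 is an arbitrary choice, see
  \<open>at_within_trunc_cone\<close>.\<close>

abbreviation nt :: "real \<Rightarrow> complex filter"
  where "nt \<alpha> \<equiv> at 0 within trunc_cone \<alpha> 1"

lemma at_within_trunc_cone: "\<beta> > 0 \<Longrightarrow> at 0 within trunc_cone \<alpha> \<beta> = nt \<alpha>"
  by (rule at_within_nhd[of _ "ball 0 (min 1 \<beta>)"]) (auto simp: trunc_cone_def)

lemma nontangential_lim_iff: "nontangential_lim f l \<longleftrightarrow> (\<forall>\<alpha>>0. (f \<longlongrightarrow> l) (nt \<alpha>))"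
  unfolding nontangential_lim_def using at_within_trunc_cone zero_less_one by metis

lemma eventually_ntI:
  assumes "\<gamma> > 0" "\<And>z. z \<in> trunc_cone \<alpha> \<gamma> \<Longrightarrow> P z"
  shows "eventually P (nt \<alpha>)"
  unfolding at_within_trunc_cone[OF assms(1), symmetric] eventually_at_filter using assms(2) by simp

lemma eventually_ntE:
  assumes "eventually P (nt \<alpha>)" "\<alpha> > 0"
  obtains \<gamma> where "\<gamma> > 0" "\<And>z. z \<in> trunc_cone \<alpha> \<gamma> \<Longrightarrow> P z"
proof -
  obtain d where d: "d > 0" "\<And>z. z \<in> trunc_cone \<alpha> 1 \<Longrightarrow> z \<noteq> 0 \<Longrightarrow> dist z 0 < d \<Longrightarrow> P z"
    using assms(1) unfolding eventually_at by blast
  show ?thesis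
  proof (rule that[of "min d 1"])
    fix z assume z: "z \<in> trunc_cone \<alpha> (min d 1)"
    moreover have "z \<noteq> 0" using trunc_cone_Im_neg[OF assms(2) z] by auto
    ultimately show "P z" using d(2)[of z] by (auto simp: trunc_cone_def)
  qed (use d in auto)
qed

lemma eventually_nt_Im: "\<alpha> > 0 \<Longrightarrow> \<forall>\<^sub>F z in nt \<alpha>. Im z < 0 \<and> z \<noteq> 0"
  by (rule eventually_ntI[of 1]) (auto dest: trunc_cone_Im_neg)

lemma nt_eventually_nonzero_power: "\<forall>\<^sub>F z in nt \<alpha>. z ^ n \<noteq> 0"
  by (rule eventually_at_filter[THEN iffD2]) auto

lemma power_bigo_nt:
  assumes "m \<le> n"
  shows "(\<lambda>z. z ^ n) \<in> O[nt \<alpha>](\<lambda>z. z ^ m)"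
proof (rule bigoI_tendsto[OF _ nt_eventually_nonzero_power])
  have "((\<lambda>z. z ^ (n - m)) \<longlongrightarrow> 0 ^ (n - m)) (nt \<alpha>)" by (intro tendsto_intros)
  moreover have "\<forall>\<^sub>F z in nt \<alpha>. z ^ n / z ^ m = z ^ (n - m)"
    using assms by (auto simp: eventually_at_filter power_diff)
  ultimately show "((\<lambda>z. z ^ n / z ^ m) \<longlongrightarrow> 0 ^ (n - m)) (nt \<alpha>)" by (simp add: tendsto_cong)
qed

lemma power_smallo_nt:
  assumes "m < n"
  shows "(\<lambda>z. z ^ n) \<in> o[nt \<alpha>](\<lambda>z. z ^ m)"
proof (rule smalloI_tendsto[OF _ nt_eventually_nonzero_power])
  have "((\<lambda>z. z ^ (n - m)) \<longlongrightarrow> 0 ^ (n - m)) (nt \<alpha>)" by (intro tendsto_intros)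
  moreover have "\<forall>\<^sub>F z in nt \<alpha>. z ^ n / z ^ m = z ^ (n - m)"
    using assms by (auto simp: eventually_at_filter power_diff)
  ultimately show "((\<lambda>z. z ^ n / z ^ m) \<longlongrightarrow> 0) (nt \<alpha>)" using assms by (simp add: tendsto_cong power_0_left)
qed

lemma id_bigo_nt: "(\<lambda>z. z) \<in> O[nt \<alpha>](\<lambda>_. 1)"
  using power_bigo_nt[of 0 1 \<alpha>] by simp

lemma smallo_diff_trans:
  fixes f g h :: "'b \<Rightarrow> 'a::real_normed_field"
  assumes "(\<lambda>x. f x - g x) \<in> o[F](u)" "(\<lambda>x. g x - h x) \<in> o[F](u)"
  shows "(\<lambda>x. f x - h x) \<in> o[F](u)"
  using sum_in_smallo(1)[OF assms] by simp

lemma smallo_diff_commute: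
  fixes f g :: "'b \<Rightarrow> 'a::real_normed_field"
  assumes "(\<lambda>x. f x - g x) \<in> o[F](u)"
  shows "(\<lambda>x. g x - f x) \<in> o[F](u)"
proof -
  have "(\<lambda>x. - (f x - g x)) \<in> o[F](u)" using assms by (simp only: landau_o.small.uminus_in_iff)
  thus ?thesis by simp
qed

section \<open>Exchanging z and w = G(1/z)\<close>

context real_distribution
begin

lemma eventually_cauchy_recip: "\<alpha> > 0 \<Longrightarrow> \<forall>\<^sub>F z in nt \<alpha>. cauchy_recip z = z * res_int 0 z"
  using eventually_nt_Im by (rule eventually_mono) (auto simp: cauchy_recip_eq)

lemma cauchy_recip_tendsto_0:
  assumes "\<alpha> > 0"
  shows "(cauchy_recip \<longlongrightarrow> 0) (nt \<alpha>)"
proof -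
  have "((\<lambda>z. z * res_int 0 z) \<longlongrightarrow> 0 * 1) (nt \<alpha>)"
    using assms by (intro tendsto_intros tendsto_res_int_0)
  thus ?thesis using tendsto_cong[OF eventually_cauchy_recip[OF assms]] by simp
qed

lemma cauchy_recip_bigo: "\<alpha> > 0 \<Longrightarrow> cauchy_recip \<in> O[nt \<alpha>](\<lambda>_. 1)"
  using cauchy_recip_tendsto_0[of \<alpha>] by (intro bigoI_tendsto) auto

text \<open>G(1/z) - z is small relative to z, so the image stays in a cone of slope enlarged by 1.
  This pulls limits in w back to limits in z.\<close>

lemma filterlim_cauchy_recip_nt:
  assumes \<alpha>: "\<alpha> > 0"
  shows "filterlim cauchy_recip (nt (\<alpha> + 1)) (nt \<alpha>)"
proof -
  have "1 / ((\<alpha> + 1) * (\<alpha> + 2)) > 0" using \<alpha> by simp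
  then obtain \<gamma> where \<gamma>: "\<gamma> > 0"
    "\<And>z. z \<in> trunc_cone \<alpha> \<gamma> \<Longrightarrow> cmod (cauchy_recip z - z) \<le> 1 / ((\<alpha> + 1) * (\<alpha> + 2)) * cmod z"
    using cauchy_recip_close[OF \<alpha>] by metis
  have "\<forall>\<^sub>F z in nt \<alpha>. cauchy_recip z \<in> trunc_cone (\<alpha> + 1) 1 \<and> cauchy_recip z \<noteq> 0"
  proof (rule eventually_ntI[of "min \<gamma> (1 / 2)"])
    fix z assume z: "z \<in> trunc_cone \<alpha> (min \<gamma> (1 / 2))"
    have "cauchy_recip z \<in> trunc_cone (\<alpha> + 1) (2 * (1 / 2))"
      using trunc_cone_perturb(1)[OF \<alpha>, of z "1 / 2" "cauchy_recip z"] \<gamma>(2)[of z] z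
      by (auto simp: trunc_cone_def)
    thus "cauchy_recip z \<in> trunc_cone (\<alpha> + 1) 1 \<and> cauchy_recip z \<noteq> 0"
      using cauchy_recip_nonzero[OF trunc_cone_Im_neg[OF \<alpha> z]] by simp
  qed (use \<gamma> in auto)
  thus ?thesis using cauchy_recip_tendsto_0[OF \<alpha>] by (simp add: filterlim_at)
qed

text \<open>The direction opposite to \<open>filterlim_cauchy_recip_nt\<close>: by
  \<open>cauchy_recip_covers\<close>, every small w in the cone has a small preimage z in the wider
  cone.\<close>

lemma eventually_nt_cauchy_recip:
  assumes \<alpha>: "\<alpha> > 0" and P: "\<forall>\<^sub>F z in nt (\<alpha> + 1). P (cauchy_recip z)"
  shows "eventually P (nt \<alpha>)"
proof -
  obtain \<gamma> where \<gamma>: "\<gamma> > 0" "\<And>z. z \<in> trunc_cone (\<alpha> + 1) \<gamma> \<Longrightarrow> P (cauchy_recip z)"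
    using eventually_ntE[OF P] \<alpha> by auto
  obtain \<beta> where "\<beta> > 0" "\<And>w. w \<in> trunc_cone \<alpha> \<beta> \<Longrightarrow> \<exists>z\<in>trunc_cone (\<alpha> + 1) \<gamma>. cauchy_recip z = w"
    using cauchy_recip_covers[OF \<alpha> \<gamma>(1)] by blast
  thus ?thesis using \<gamma>(2) by (intro eventually_ntI[of \<beta>]) blast+
qed

text \<open>Eliminates \<open>L\<close>: at w = G(1/z) the value of \<open>L\<close> is z itself, so
  \<open>R\<close> becomes explicit in the variable z.\<close>

lemma R_transform_cauchy_recip:
  assumes R: "is_R_transform M D R" and \<alpha>: "\<alpha> > 0"
  shows "\<forall>\<^sub>F z in nt \<alpha>. cauchy_recip z \<in> D \<and> R (cauchy_recip z) = 1 / z - 1 / cauchy_recip z"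
proof -
  obtain A L where A:
    "\<forall>\<alpha>>0. \<forall>\<^sub>F \<beta> in at_right 0. (\<alpha>, \<beta>) \<in> A"
    "\<forall>(\<alpha>, \<beta>)\<in>A. \<forall>z\<in>trunc_cone \<alpha> \<beta>. L (cauchy_recip z) = z"
    "D = (\<Union>(\<alpha>, \<beta>)\<in>A. cauchy_recip ` trunc_cone \<alpha> \<beta>)"
    "\<forall>w\<in>D. R w = 1 / L w - 1 / w"
    using R unfolding is_R_transform_def by blast
  have "\<forall>\<^sub>F \<beta> in at_right 0. (\<alpha>, \<beta>) \<in> A \<and> \<beta> > 0"
    using A(1) \<alpha> by (intro eventually_conj eventually_at_right_less) auto
  then obtain \<beta> where \<beta>: "(\<alpha>, \<beta>) \<in> A" "\<beta> > 0"
    using eventually_happens'[OF trivial_limit_at_right_real] by blast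
  show ?thesis
  proof (rule eventually_ntI[OF \<beta>(2)])
    fix z assume z: "z \<in> trunc_cone \<alpha> \<beta>"
    have "cauchy_recip z \<in> D" using A(3) \<beta>(1) z by blast
    moreover have "L (cauchy_recip z) = z" using A(2) \<beta>(1) z by blast
    ultimately show "cauchy_recip z \<in> D \<and> R (cauchy_recip z) = 1 / z - 1 / cauchy_recip z"
      using A(4) by simp
  qed
qed

lemma eventually_R_transform_domain:
  assumes "is_R_transform M D R" "\<alpha> > 0"
  shows "\<forall>\<^sub>F w in nt \<alpha>. w \<in> D"
  by (rule eventually_nt_cauchy_recip[where P = "\<lambda>w. w \<in> D", OF assms(2)])
     (use R_transform_cauchy_recip[OF assms(1), of "\<alpha> + 1"] assms(2) in \<open>simp add: eventually_conj_iff\<close>)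

lemma R_transform_domain_nonzero:
  assumes "is_R_transform M D R"
  shows "0 \<notin> D"
proof
  assume "0 \<in> D"
  then obtain A where "\<forall>(\<alpha>, \<beta>)\<in>A. \<alpha> > 0 \<and> \<beta> > 0" "0 \<in> (\<Union>(\<alpha>, \<beta>)\<in>A. cauchy_recip ` trunc_cone \<alpha> \<beta>)"
    using assms unfolding is_R_transform_def by blast
  then obtain \<alpha> \<beta> z where "\<alpha> > 0" "z \<in> trunc_cone \<alpha> \<beta>" "cauchy_recip z = 0"
    by auto
  thus False using cauchy_recip_nonzero trunc_cone_Im_neg by blast
qed

text \<open>The domain is a union of images of cones. Each image is open and connected, any two meet
  at G(1/z) for a point z near 0 on the negative imaginary axis, and on each of them the given
  \<open>L\<close> agrees with a holomorphic inverse.\<close>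

lemma class_H_R_transform:
  assumes R: "is_R_transform M D R"
  shows "class_H D R"
proof -
  obtain A L where A0: "\<forall>(\<alpha>, \<beta>)\<in>A. \<alpha> > 0 \<and> \<beta> > 0"
    and "\<forall>\<alpha>>0. \<forall>\<^sub>F \<beta> in at_right 0. (\<alpha>, \<beta>) \<in> A"
    and A1: "\<forall>(\<alpha>, \<beta>)\<in>A. \<forall>z\<in>trunc_cone \<alpha> \<beta>. L (cauchy_recip z) = z"
    and D: "D = (\<Union>(\<alpha>, \<beta>)\<in>A. cauchy_recip ` trunc_cone \<alpha> \<beta>)"
    and RL: "\<forall>w\<in>D. R w = 1 / L w - 1 / w"
    using R unfolding is_R_transform_def by blast
  define I where "I x = cauchy_recip ` trunc_cone (fst x) (snd x)" for x
  have D': "D = (\<Union>x\<in>A. I x)" unfolding D I_def by (simp add: case_prod_beta)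
  have pos: "fst x > 0" "snd x > 0" if "x \<in> A" for x using A0 that by auto
  have Lz: "L (cauchy_recip z) = z" if "x \<in> A" "z \<in> trunc_cone (fst x) (snd x)" for x z
    using A1 that by (auto simp: case_prod_beta)
  have inj: "inj_on cauchy_recip (trunc_cone (fst x) (snd x))" if "x \<in> A" for x
    using Lz[OF that] by (rule inj_on_inverseI)
  note hol = cauchy_recip_holomorphic[OF pos(1)]
  have opn: "open (I x)" if "x \<in> A" for x
    unfolding I_def by (rule open_mapping_thm3[OF hol[OF that] open_trunc_cone inj[OF that]])
  have con: "connected (I x)" if "x \<in> A" for x
    unfolding I_def using hol[OF that] convex_trunc_cone
    by (intro connected_continuous_image holomorphic_on_imp_continuous_on convex_connected)
  have meet: "I x \<inter> I y \<noteq> {}" if xy: "x \<in> A" "y \<in> A" for x y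
  proof -
    define e where "e = min (snd x) (snd y) / 2"
    have e: "0 < e" "e < snd x" "e < snd y"
      using pos[OF xy(1)] pos[OF xy(2)] by (auto simp: e_def)
    have "- \<i> * complex_of_real e \<in> trunc_cone (fst x) (snd x)" "- \<i> * complex_of_real e \<in> trunc_cone (fst y) (snd y)"
      using pos[OF xy(1)] pos[OF xy(2)] e by (simp_all only: minus_ii_in_trunc_cone)
    thus ?thesis unfolding I_def by blast
  qed
  have "connected D"
  proof (cases "A = {}")
    case False
    then obtain x where x: "x \<in> A" by blast
    have "connected (I x \<union> \<Union>(I ` A))"
    proof (rule connected_Un_UN[OF con[OF x]])
      show "connected X" if "X \<in> I ` A" for X using that con by (elim imageE) simp
      show "I x \<inter> X \<noteq> {}" if "X \<in> I ` A" for X using that meet[OF x] by (elim imageE) simp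
    qed
    moreover have "I x \<union> \<Union>(I ` A) = D" unfolding D' using x by auto
    ultimately show ?thesis by simp
  qed (simp add: D')
  moreover have "R holomorphic_on D"
    unfolding D'
  proof (rule holomorphic_on_UN_open)
    fix x assume x: "x \<in> A"
    obtain g where g: "g holomorphic_on I x"
        "\<And>z. z \<in> trunc_cone (fst x) (snd x) \<Longrightarrow> deriv cauchy_recip z * deriv g (cauchy_recip z) = 1"
        "\<And>z. z \<in> trunc_cone (fst x) (snd x) \<Longrightarrow> g (cauchy_recip z) = z"
      by (rule holomorphic_has_inverse[OF hol[OF x] open_trunc_cone inj[OF x], folded I_def], rule that)
    have "(\<lambda>w. 1 / g w - 1 / w) holomorphic_on I x"
    proof (intro holomorphic_intros g(1))
      fix w assume "w \<in> I x"
      then obtain z where z: "z \<in> trunc_cone (fst x) (snd x)" "w = cauchy_recip z" by (auto simp: I_def)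
      have "Im z < 0" by (rule trunc_cone_Im_neg[OF pos(1)[OF x] z(1)])
      moreover have "g w = z" using g(3)[OF z(1)] z(2) by simp
      ultimately show "g w \<noteq> 0" by auto
      show "w \<noteq> 0" using cauchy_recip_nonzero[OF \<open>Im z < 0\<close>] z(2) by simp
    qed
    thus "R holomorphic_on I x"
    proof (rule holomorphic_transform)
      fix w assume w: "w \<in> I x"
      then obtain z where z: "z \<in> trunc_cone (fst x) (snd x)" "w = cauchy_recip z" by (auto simp: I_def)
      have "w \<in> D" unfolding D' using x w by (rule UN_I)
      thus "1 / g w - 1 / w = R w" using RL Lz[OF x z(1)] g(3)[OF z(1)] z(2) by simp
    qed
  qed (use opn in auto)
  moreover have oD: "open D" unfolding D' by (rule open_UN) (use opn in simp)
  moreover have "\<exists>\<beta>>0. trunc_cone \<alpha> \<beta> \<subseteq> D" if "\<alpha> > 0" for \<alpha>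
    by (rule eventually_ntE[OF eventually_R_transform_domain[OF R that] that]) auto
  ultimately show ?thesis unfolding class_H_def by (simp add: analytic_on_open)
qed

text \<open>On \<open>D\<close> the remainder is forced to be the quotient, which is analytic there
  because \<open>0\<close> is not in \<open>D\<close>. Its limit may be checked in the variable z by
  \<open>eventually_nt_cauchy_recip\<close>.\<close>

lemma has_taylor_expansion_R_transformI:
  assumes R: "is_R_transform M D R"
    and lim: "\<And>\<alpha>. \<alpha> > 0 \<Longrightarrow> ((\<lambda>z. (R (cauchy_recip z) - (\<Sum>i\<le>q. a i * cauchy_recip z ^ i)) / cauchy_recip z ^ q) \<longlongrightarrow> 0) (nt \<alpha>)"
  shows "has_taylor_expansion D R q a"
proof -
  define \<upsilon> where "\<upsilon> w = (R w - (\<Sum>i\<le>q. a i * w ^ i)) / w ^ q" for w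
  note H = class_H_R_transform[OF R]
  note nz = R_transform_domain_nonzero[OF R]
  have "\<upsilon> analytic_on D"
    unfolding \<upsilon>_def using H nz by (intro analytic_intros) (auto simp: class_H_def)
  hence "class_H D \<upsilon>" using H by (simp add: class_H_def)
  moreover have "nontangential_lim \<upsilon> 0"
    unfolding nontangential_lim_iff
  proof (intro allI impI tendstoI)
    fix \<alpha> e :: real assume "\<alpha> > 0" "e > 0"
    have "\<forall>\<^sub>F z in nt (\<alpha> + 1). dist (\<upsilon> (cauchy_recip z)) 0 < e"
      unfolding \<upsilon>_def using \<open>\<alpha> > 0\<close> \<open>e > 0\<close> by (intro tendstoD[OF lim]) auto
    thus "\<forall>\<^sub>F w in nt \<alpha>. dist (\<upsilon> w) 0 < e" by (rule eventually_nt_cauchy_recip[OF \<open>\<alpha> > 0\<close>])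
  qed
  moreover have "R w = (\<Sum>i\<le>q. a i * w ^ i) + w ^ q * \<upsilon> w" if "w \<in> D" for w
    using that nz by (auto simp: \<upsilon>_def)
  ultimately show ?thesis using H unfolding has_taylor_expansion_def by blast
qed

section \<open>From moments to the expansion of R\<close>

lemma res_int_0_moment_expansion:
  assumes n: "has_moment M n" and \<alpha>: "\<alpha> > 0"
  shows "(\<lambda>z. res_int 0 z - poly (\<Sum>i\<le>n. monom (complex_of_real (moment M i)) i) z) \<in> o[nt \<alpha>](\<lambda>z. z ^ n)"
proof (rule smalloI_tendsto[OF _ nt_eventually_nonzero_power])
  have "\<forall>\<^sub>F z in nt \<alpha>. (res_int 0 z - poly (\<Sum>i\<le>n. monom (complex_of_real (moment M i)) i) z) / z ^ n =
     z * res_int (Suc n) z"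
    using eventually_nt_Im[OF \<alpha>]
  proof eventually_elim
    case (elim z)
    thus ?case using res_int_expand[OF n, of z] by (simp add: poly_sum poly_monom)
  qed
  thus "((\<lambda>z. (res_int 0 z - poly (\<Sum>i\<le>n. monom (complex_of_real (moment M i)) i) z) / z ^ n) \<longlongrightarrow> 0) (nt \<alpha>)"
    using tendsto_mult_res_int[OF n \<alpha>] by (simp add: tendsto_cong)
qed

text \<open>One order is gained because w - z Q(z) = z (h(z) - Q(z)), and polynomials are Lipschitz
  on bounded sets.\<close>

lemma smallo_poly_cauchy_recip:
  assumes \<alpha>: "\<alpha> > 0" and Q: "(\<lambda>z. res_int 0 z - poly Q z) \<in> o[nt \<alpha>](\<lambda>z. z ^ n)"
  shows "(\<lambda>z. poly C (cauchy_recip z) - poly C (z * poly Q z)) \<in> o[nt \<alpha>](\<lambda>z. z ^ Suc n)"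
proof -
  have "(\<lambda>z. z * poly Q z) \<in> O[nt \<alpha>](\<lambda>_. 1)"
    using landau_o.big.mult[OF id_bigo_nt bigo_1_poly[OF id_bigo_nt]] by simp
  hence "(\<lambda>z. poly C (cauchy_recip z) - poly C (z * poly Q z)) \<in> O[nt \<alpha>](\<lambda>z. cauchy_recip z - z * poly Q z)"
    by (rule bigo_poly_diff[OF cauchy_recip_bigo[OF \<alpha>]])
  also have "(\<lambda>z. cauchy_recip z - z * poly Q z) \<in> o[nt \<alpha>](\<lambda>z. z ^ Suc n)"
  proof -
    have "(\<lambda>z. z * (res_int 0 z - poly Q z)) \<in> o[nt \<alpha>](\<lambda>z. z * z ^ n)"
      by (rule landau_o.big_small_mult[OF landau_o.big_refl Q])
    moreover have "\<forall>\<^sub>F z in nt \<alpha>. cauchy_recip z - z * poly Q z = z * (res_int 0 z - poly Q z)"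
      using eventually_cauchy_recip[OF \<alpha>] by eventually_elim (simp add: algebra_simps)
    ultimately show ?thesis by (subst landau_o.small.in_cong) auto
  qed
  finally show ?thesis .
qed

lemma moment_imp_R_transform_expansion:
  assumes R: "is_R_transform M D R" and p: "p > 0" and m: "has_moment M p"
  shows "has_taylor_expansion D R (p - 1) (\<lambda>i. complex_of_real (free_cumulant M (i + 1)))"
proof (rule has_taylor_expansion_R_transformI[OF R])
  fix \<alpha> :: real assume \<alpha>: "\<alpha> > 0"
  \<comment> \<open>The value 1 at index 0 supplies the constant term of \<open>C\<close> and meets
    the convention of the recursion for \<open>nc_sum\<close>.\<close>
  define k where "k i = (if i = 0 then 1 else free_cumulant M i)" for i
  define kc where "kc i = complex_of_real (k i)" for i
  define Q where "Q = (\<Sum>i\<le>p. monom (complex_of_real (moment M i)) i)"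
  define C where "C = (\<Sum>s\<le>p. monom (kc s) s)"
  have mom: "complex_of_real (moment M i) = (\<Sum>\<pi>\<in>noncrossing_partitions i. \<Prod>V\<in>\<pi>. kc (card V))" if "i \<le> p" for i
  proof (cases "i = 0")
    case True
    have "kc 0 = 1" by (simp add: kc_def k_def)
    thus ?thesis using True moment_0 by (simp add: sum_noncrossing_partitions[where k = kc] nc_sum_empty)
  next
    case False
    have "moment_cumulant_eqs M p k" unfolding free_cumulant_iff by (simp add: k_def)
    hence "moment M i = (\<Sum>\<pi>\<in>noncrossing_partitions i. \<Prod>V\<in>\<pi>. k (card V))"
      using False that by (simp add: moment_cumulant_eqs_def)
    thus ?thesis by (simp add: kc_def)
  qed
  have "monom 1 (Suc p) dvd Q - (\<Sum>s\<le>p. smult (kc s) ((monom 1 1 * Q) ^ s))"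
  proof -
    have "Q = (\<Sum>i\<le>p. monom (\<Sum>\<pi>\<in>noncrossing_partitions i. \<Prod>V\<in>\<pi>. kc (card V)) i)"
      unfolding Q_def using mom by (intro sum.cong arg_cong2[of _ _ _ _ monom] refl) simp
    moreover have "kc 0 = 1" by (simp add: kc_def k_def)
    ultimately show ?thesis using moment_cumulant_poly_dvd[of kc p] by (simp only:)
  qed
  then obtain P where P: "Q - (\<Sum>s\<le>p. smult (kc s) ((monom 1 1 * Q) ^ s)) = monom 1 (Suc p) * P" by (elim dvdE)
  have pP: "poly Q z - poly C (z * poly Q z) = z ^ Suc p * poly P z" for z
  proof -
    have "poly C x = (\<Sum>s\<le>p. kc s * x ^ s)" for x by (simp add: C_def poly_sum poly_monom)
    thus ?thesis using arg_cong[OF P, of "\<lambda>q. poly q z"]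
      by (simp only: poly_diff poly_sum poly_smult poly_power poly_mult poly_monom mult_1 power_one_right)
  qed
  have hQ: "(\<lambda>z. res_int 0 z - poly Q z) \<in> o[nt \<alpha>](\<lambda>z. z ^ p)"
    unfolding Q_def by (rule res_int_0_moment_expansion[OF m \<alpha>])
  have "(\<lambda>z. z ^ Suc p * poly P z) \<in> O[nt \<alpha>](\<lambda>z. z ^ Suc p * 1)"
    by (intro landau_o.big.mult landau_o.big_refl bigo_1_poly id_bigo_nt)
  also have "(\<lambda>z. z ^ Suc p * 1) \<in> o[nt \<alpha>](\<lambda>z. z ^ p)" using power_smallo_nt[of p "Suc p" \<alpha>] by simp
  finally have QC: "(\<lambda>z. poly Q z - poly C (z * poly Q z)) \<in> o[nt \<alpha>](\<lambda>z. z ^ p)" unfolding pP .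
  have CC: "(\<lambda>z. poly C (cauchy_recip z) - poly C (z * poly Q z)) \<in> o[nt \<alpha>](\<lambda>z. z ^ p)"
    by (rule landau_o.small_big_trans[OF smallo_poly_cauchy_recip[OF \<alpha> hQ] power_bigo_nt]) simp
  have "(\<lambda>z. res_int 0 z - poly C (cauchy_recip z)) \<in> o[nt \<alpha>](\<lambda>z. z ^ p)"
    by (rule smallo_diff_trans[OF smallo_diff_trans[OF hQ QC] smallo_diff_commute[OF CC]])
  \<comment> \<open>Here w^p = z^p h(z)^p, and h -> 1 converts the order in z into the order in
    w.\<close>
  hence "((\<lambda>z. (res_int 0 z - poly C (cauchy_recip z)) / z ^ p / res_int 0 z ^ p) \<longlongrightarrow> 0 / 1 ^ p) (nt \<alpha>)"
    by (rule tendsto_divide[OF smalloD_tendsto tendsto_power[OF tendsto_res_int_0[OF \<alpha>]]]) simp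
  moreover have "\<forall>\<^sub>F z in nt \<alpha>.
      (R (cauchy_recip z) - (\<Sum>i\<le>p - 1. complex_of_real (free_cumulant M (i + 1)) * cauchy_recip z ^ i)) / cauchy_recip z ^ (p - 1) =
      (res_int 0 z - poly C (cauchy_recip z)) / z ^ p / res_int 0 z ^ p"
    using R_transform_cauchy_recip[OF R \<alpha>] eventually_nt_Im[OF \<alpha>]
  proof eventually_elim
    case (elim z)
    define w where "w = cauchy_recip z"
    have w: "w = z * res_int 0 z" unfolding w_def using elim by (intro cauchy_recip_eq) auto
    have w0: "w \<noteq> 0" unfolding w_def using elim by (intro cauchy_recip_nonzero) auto
    obtain q where q: "p = Suc q" using p by (cases p) auto
    have "poly C w = (\<Sum>i\<le>Suc q. kc i * w ^ i)" by (simp add: C_def poly_sum poly_monom q)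
    also have "\<dots> = 1 + w * (\<Sum>i\<le>q. complex_of_real (free_cumulant M (i + 1)) * w ^ i)"
      by (subst sum.atMost_Suc_shift) (simp add: kc_def k_def sum_distrib_left mult_ac)
    finally have C: "poly C w = 1 + w * (\<Sum>i\<le>q. complex_of_real (free_cumulant M (i + 1)) * w ^ i)" .
    have "w * R w = res_int 0 z - 1"
      using elim w0 w by (simp add: w_def[symmetric] right_diff_distrib)
    hence "w * (R w - (\<Sum>i\<le>q. complex_of_real (free_cumulant M (i + 1)) * w ^ i)) = res_int 0 z - poly C w"
      unfolding C by (simp add: algebra_simps)
    hence "(R w - (\<Sum>i\<le>q. complex_of_real (free_cumulant M (i + 1)) * w ^ i)) = (res_int 0 z - poly C w) / w"
      using w0 by (simp add: field_simps)
    moreover have "z ^ p * res_int 0 z ^ p = w * w ^ q" by (simp add: w q power_mult_distrib)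
    ultimately show ?case unfolding w_def[symmetric] by (simp add: q)
  qed
  ultimately show "((\<lambda>z. (R (cauchy_recip z) - (\<Sum>i\<le>p - 1. complex_of_real (free_cumulant M (i + 1)) * cauchy_recip z ^ i)) /
       cauchy_recip z ^ (p - 1)) \<longlongrightarrow> 0) (nt \<alpha>)"
    by (simp add: tendsto_cong)
qed

end


section \<open>From expansions to moments\<close>

text \<open>The complement of the support is a union of open null sets, and by Lindelof countably
  many of them suffice.\<close>

lemma AE_in_measure_support:
  fixes \<mu> :: "'a::second_countable_topology measure"
  assumes "sets \<mu> = sets borel"
  shows "AE t in \<mu>. t \<in> measure_support \<mu>"
proof -
  define \<U> where "\<U> = {U. open U \<and> emeasure \<mu> U = 0}"
  obtain \<V> where \<V>: "\<V> \<subseteq> \<U>" "countable \<V>" "\<Union>\<V> = \<Union>\<U>"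
    using Lindelof[of \<U>] unfolding \<U>_def by blast
  have "U \<in> null_sets \<mu>" if "U \<in> \<V>" for U
    using that \<V>(1) assms by (auto simp: \<U>_def null_sets_def)
  hence "\<Union>\<V> \<in> null_sets \<mu>" using \<V>(2) null_sets_UN'[of \<V> "\<lambda>U. U" \<mu>] by simp
  moreover have "{t \<in> space \<mu>. t \<notin> measure_support \<mu>} \<subseteq> \<Union>\<U>"
    by (auto simp: measure_support_def \<U>_def not_gr_zero)
  ultimately show ?thesis unfolding \<V>(3)[symmetric] by (rule AE_I')
qed

text \<open>Fatou's lemma for the functions \<open>f k t + K\<close>, which are nonnegative almost
  everywhere; adding the constant raises each integral by exactly \<open>K\<close>, as the total
  mass is 1.\<close>

lemma (in prob_space) integrable_of_liminf_bound:
  fixes f :: "nat \<Rightarrow> 'a \<Rightarrow> real"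
  assumes f: "\<And>k. integrable M (f k)" and K: "\<And>k. AE t in M. - K \<le> f k t"
    and lim: "\<And>t. (\<lambda>k. f k t) \<longlonglongrightarrow> g t"
    and B: "\<forall>\<^sub>F k in sequentially. (\<integral>t. f k t \<partial>M) \<le> B"
  shows "integrable M g"
proof -
  have gm [measurable]: "g \<in> borel_measurable M"
    by (rule borel_measurable_LIMSEQ_real[OF lim]) (use f in auto)
  have fm [measurable]: "f k \<in> borel_measurable M" for k using f by auto
  have AEf: "AE t in M. \<forall>k. - K \<le> f k t" using K by (simp add: AE_all_countable)
  have gK: "AE t in M. - K \<le> g t"
    using AEf by eventually_elim (rule tendsto_lowerbound[OF lim], auto)
  have "(\<integral>\<^sup>+t. ennreal (norm (g t + K)) \<partial>M) = (\<integral>\<^sup>+t. liminf (\<lambda>k. ennreal (f k t + K)) \<partial>M)"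
  proof (rule nn_integral_cong_AE)
    show "AE t in M. ennreal (norm (g t + K)) = liminf (\<lambda>k. ennreal (f k t + K))"
      using gK
    proof eventually_elim
      case (elim t)
      have "(\<lambda>k. ennreal (f k t + K)) \<longlonglongrightarrow> ennreal (g t + K)"
        by (intro tendsto_ennrealI tendsto_intros lim)
      hence "liminf (\<lambda>k. ennreal (f k t + K)) = ennreal (g t + K)"
        by (intro lim_imp_Liminf) auto
      thus ?case using elim by simp
    qed
  qed
  also have "\<dots> \<le> liminf (\<lambda>k. \<integral>\<^sup>+t. ennreal (f k t + K) \<partial>M)"
    by (rule nn_integral_liminf) simp
  also have "\<dots> \<le> limsup (\<lambda>k. \<integral>\<^sup>+t. ennreal (f k t + K) \<partial>M)"
    by (rule Liminf_le_Limsup) simp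
  also have "\<dots> \<le> ennreal (B + K)"
  proof (rule Limsup_bounded)
    show "\<forall>\<^sub>F k in sequentially. (\<integral>\<^sup>+t. ennreal (f k t + K) \<partial>M) \<le> ennreal (B + K)"
      using B
    proof eventually_elim
      case (elim k)
      have "(\<integral>\<^sup>+t. ennreal (f k t + K) \<partial>M) = ennreal (\<integral>t. f k t + K \<partial>M)"
      proof (rule nn_integral_eq_integral)
        show "AE t in M. 0 \<le> f k t + K" using K[of k] by eventually_elim simp
      qed (use f in auto)
      also have "(\<integral>t. f k t + K \<partial>M) = (\<integral>t. f k t \<partial>M) + K" using f prob_space by simp
      finally show ?case using elim by (simp add: ennreal_leI)
    qed
  qed
  finally have "(\<integral>\<^sup>+t. ennreal (norm (g t + K)) \<partial>M) < \<infinity>"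
    by (rule order.strict_trans1) simp
  hence "integrable M (\<lambda>t. g t + K)" by (intro integrableI_bounded) auto
  hence "integrable M (\<lambda>t. (g t + K) - K)" by (rule Bochner_Integration.integrable_diff) simp
  thus ?thesis by simp
qed

section \<open>Real coefficients and the negative imaginary axis\<close>

lemma Reals_coeff_mult:
  assumes "\<forall>i. coeff p i \<in> \<real>" "\<forall>i. coeff q i \<in> \<real>"
  shows "\<forall>i. coeff (p * q) i \<in> \<real>"
  using assms by (auto simp: coeff_mult intro!: sum_in_Reals Reals_mult)

lemma Reals_coeff_pCons: "a \<in> \<real> \<Longrightarrow> \<forall>i. coeff p i \<in> \<real> \<Longrightarrow> \<forall>i. coeff (pCons a p) i \<in> \<real>"
  by (auto simp: coeff_pCons split: nat.split)

lemma Reals_coeff_pcompose: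
  assumes "\<forall>i. coeff p i \<in> \<real>" "\<forall>i. coeff q i \<in> \<real>"
  shows "\<forall>i. coeff (pcompose p q) i \<in> \<real>"
  using assms(1)
proof (induction p)
  case (pCons a p)
  have a: "a \<in> \<real>" using pCons.prems[rule_format, of 0] by simp
  have "\<forall>i. coeff p i \<in> \<real>" using pCons.prems by (metis coeff_pCons_Suc)
  hence "\<forall>i. coeff (q * pcompose p q) i \<in> \<real>" using Reals_coeff_mult[OF assms(2)] pCons.IH by blast
  moreover have "\<forall>i. coeff [:a:] i \<in> \<real>" using a by (auto simp: coeff_pCons split: nat.split)
  ultimately show ?case by (simp add: pcompose_pCons Reals_add)
qed simp

text \<open>A sequence of heights y -> 0 for Fatou's lemma. The shift by 2 keeps all terms below 1,
  so that -iy lies in the cone of radius 1.\<close>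

definition imag_seq :: "nat \<Rightarrow> real"
  where "imag_seq k = 1 / real (k + 2)"

lemma imag_seq: "0 < imag_seq k" "imag_seq k < 1" "imag_seq \<longlonglongrightarrow> 0"
proof -
  show "imag_seq \<longlonglongrightarrow> 0"
    unfolding imag_seq_def using LIMSEQ_ignore_initial_segment[OF lim_1_over_n, of 2] by simp
qed (simp_all add: imag_seq_def)

lemma filterlim_imag_seq:
  assumes "\<alpha> > 0"
  shows "filterlim (\<lambda>k. - \<i> * complex_of_real (imag_seq k)) (nt \<alpha>) sequentially"
  unfolding filterlim_at
proof
  show "\<forall>\<^sub>F k in sequentially. - \<i> * complex_of_real (imag_seq k) \<in> trunc_cone \<alpha> 1 \<and> - \<i> * complex_of_real (imag_seq k) \<noteq> 0"
    using minus_ii_in_trunc_cone[OF assms imag_seq(1,2)] imag_seq(1) by (intro always_eventually allI conjI) (auto simp: less_imp_neq[THEN not_sym])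
  have "(\<lambda>k. - \<i> * complex_of_real (imag_seq k)) \<longlonglongrightarrow> - \<i> * complex_of_real 0"
    by (intro tendsto_intros imag_seq(3))
  thus "(\<lambda>k. - \<i> * complex_of_real (imag_seq k)) \<longlonglongrightarrow> 0" by simp
qed

lemma nt_neq_bot:
  assumes "\<alpha> > 0"
  shows "nt \<alpha> \<noteq> bot"
proof
  assume "nt \<alpha> = bot"
  hence "\<forall>\<^sub>F z in nt \<alpha>. False" by simp
  hence "\<forall>\<^sub>F k in sequentially. False"
    using filterlim_imag_seq[OF assms] by (rule eventually_compose_filterlim)
  thus False by simp
qed

text \<open>Uniqueness of expansions: the limit at 0 kills the constant term, then a factor z is
  cancelled.\<close>

lemma smallo_nt_poly_coeff_0:
  assumes \<alpha>: "\<alpha> > 0" and "poly P \<in> o[nt \<alpha>](\<lambda>z. z ^ n)" "i \<le> n"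
  shows "coeff P i = 0"
  using assms(2,3)
proof (induction n arbitrary: P i)
  case (0 P)
  have "(poly P \<longlongrightarrow> 0) (nt \<alpha>)" using smalloD_tendsto[OF 0(1)] by simp
  moreover have "(poly P \<longlongrightarrow> poly P 0) (nt \<alpha>)" by (intro tendsto_intros)
  ultimately have "poly P 0 = 0" using tendsto_unique[OF nt_neq_bot[OF \<alpha>]] by blast
  thus ?case using 0 by (simp add: poly_0_coeff_0)
next
  case (Suc n P)
  have "poly P \<in> o[nt \<alpha>](\<lambda>z. z ^ 0)"
    by (rule landau_o.small_big_trans[OF Suc.prems(1) power_bigo_nt]) simp
  hence "(poly P \<longlongrightarrow> 0) (nt \<alpha>)" using smalloD_tendsto[of "poly P"] by fastforce
  moreover have "(poly P \<longlongrightarrow> poly P 0) (nt \<alpha>)" by (intro tendsto_intros)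
  ultimately have "poly P 0 = 0" using tendsto_unique[OF nt_neq_bot[OF \<alpha>]] by blast
  then obtain P' where P: "P = pCons 0 P'" by (metis pCons_cases poly_0_coeff_0 coeff_pCons_0)
  have "(\<lambda>z. z * poly P' z) \<in> o[nt \<alpha>](\<lambda>z. z * z ^ n)" using Suc.prems(1) by (simp add: P)
  moreover have "\<forall>\<^sub>F z in nt \<alpha>. z \<noteq> 0" using nt_eventually_nonzero_power[where n = 1] by simp
  ultimately have "poly P' \<in> o[nt \<alpha>](\<lambda>z. z ^ n)" by (simp add: landau_o.small.mult_cancel_left)
  thus ?case using Suc.IH[of P'] Suc.prems(2) P by (cases i) auto
qed

text \<open>At z = -iy with y = \<open>imag_seq k\<close> one has 1/(1 - zt) = (1 - iyt)/(1 + y^2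
  t^2), so these damped powers are, up to a factor -y, the real and imaginary parts of the integrand
  of \<open>res_int\<close>.\<close>

definition cut_moment :: "nat \<Rightarrow> nat \<Rightarrow> real \<Rightarrow> real"
  where "cut_moment m k t = t ^ m / (1 + (imag_seq k * t)\<^sup>2)"

lemma cut_moment_tendsto: "(\<lambda>k. cut_moment m k t) \<longlonglongrightarrow> t ^ m"
proof -
  have "(\<lambda>k. t ^ m / (1 + (imag_seq k * t)\<^sup>2)) \<longlonglongrightarrow> t ^ m / (1 + (0 * t)\<^sup>2)"
    by (intro tendsto_intros imag_seq(3)) simp
  thus ?thesis by (simp add: cut_moment_def)
qed

text \<open>Dividing by a number >= 1 moves a value towards 0, so a lower bound \<open>- K\<close>
  or an upper bound \<open>K\<close> with \<open>K \<ge> 0\<close> is kept.\<close>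

lemma cut_moment_bounds: "t ^ m \<ge> - K \<Longrightarrow> K \<ge> 0 \<Longrightarrow> cut_moment m k t \<ge> - K"
  "t ^ m \<le> K \<Longrightarrow> K \<ge> 0 \<Longrightarrow> cut_moment m k t \<le> K"
proof -
  define c where "c = 1 + (imag_seq k * t)\<^sup>2"
  have c: "c \<ge> 1" by (simp add: c_def)
  have e: "cut_moment m k t = t ^ m / c" by (simp add: cut_moment_def c_def)
  { assume *: "t ^ m \<ge> - K" "K \<ge> 0"
    have "- K * c \<le> - K * 1" using c * by (intro mult_left_mono_neg) auto
    thus "cut_moment m k t \<ge> - K" unfolding e using c * by (simp add: pos_le_divide_eq) }
  { assume *: "t ^ m \<le> K" "K \<ge> 0"
    have "K * 1 \<le> K * c" using c * by (intro mult_left_mono) auto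
    thus "cut_moment m k t \<le> K" unfolding e using c * by (simp add: pos_divide_le_eq) }
qed

section \<open>Solving the implicit equation and gaining moments\<close>

context real_distribution
begin

text \<open>Since w R(w) = h(z) - 1, an expansion of R of order \<open>q\<close> yields an
  approximation of h by a polynomial in w of order \<open>q + 1\<close>. The factor w^(q+1) of the
  remainder equals z^(q+1) h(z)^(q+1), and h -> 1.\<close>

lemma taylor_expansion_imp_smallo:
  assumes R: "is_R_transform M D R" and T: "has_taylor_expansion D R q a" and \<alpha>: "\<alpha> > 0"
  shows "(\<lambda>z. res_int 0 z - poly (pCons 1 (\<Sum>i\<le>q. monom (a i) i)) (cauchy_recip z)) \<in> o[nt \<alpha>](\<lambda>z. z ^ Suc q)"
proof -
  obtain E \<upsilon> where E: "class_H E \<upsilon>" and lim: "nontangential_lim \<upsilon> 0"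
    and eq: "\<And>w. w \<in> D \<Longrightarrow> w \<in> E \<Longrightarrow> R w = (\<Sum>i\<le>q. a i * w ^ i) + w ^ q * \<upsilon> w"
    using T unfolding has_taylor_expansion_def by blast
  note fl = filterlim_cauchy_recip_nt[OF \<alpha>]
  have \<alpha>1: "\<alpha> + 1 > 0" using \<alpha> by simp
  obtain \<beta> where \<beta>: "\<beta> > 0" "trunc_cone (\<alpha> + 1) \<beta> \<subseteq> E" using E \<alpha>1 unfolding class_H_def by blast
  have "\<forall>\<^sub>F w in nt (\<alpha> + 1). w \<in> E" by (rule eventually_ntI[OF \<beta>(1)]) (use \<beta>(2) in blast)
  hence inE: "\<forall>\<^sub>F z in nt \<alpha>. cauchy_recip z \<in> E" using fl by (rule eventually_compose_filterlim)
  have "(\<upsilon> \<longlongrightarrow> 0) (nt (\<alpha> + 1))" using lim \<alpha>1 unfolding nontangential_lim_iff by blast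
  hence l0: "((\<lambda>z. \<upsilon> (cauchy_recip z)) \<longlongrightarrow> 0) (nt \<alpha>)" using fl by (rule filterlim_compose)
  show ?thesis
  proof (rule smalloI_tendsto[OF _ nt_eventually_nonzero_power])
    have "\<forall>\<^sub>F z in nt \<alpha>. (res_int 0 z - poly (pCons 1 (\<Sum>i\<le>q. monom (a i) i)) (cauchy_recip z)) / z ^ Suc q =
        res_int 0 z ^ Suc q * \<upsilon> (cauchy_recip z)"
      using R_transform_cauchy_recip[OF R \<alpha>] inE eventually_nt_Im[OF \<alpha>]
    proof eventually_elim
      case (elim z)
      define w where "w = cauchy_recip z"
      have w: "w = z * res_int 0 z" unfolding w_def using elim by (intro cauchy_recip_eq) auto
      have w0: "w \<noteq> 0" unfolding w_def using elim by (intro cauchy_recip_nonzero) auto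
      have R1: "R w = 1 / z - 1 / w" and R2: "R w = (\<Sum>i\<le>q. a i * w ^ i) + w ^ q * \<upsilon> w"
        using elim eq unfolding w_def by auto
      have "w * R w = res_int 0 z - 1"
        unfolding R1 using elim w0 w by (simp add: right_diff_distrib)
      hence "res_int 0 z = 1 + w * ((\<Sum>i\<le>q. a i * w ^ i) + w ^ q * \<upsilon> w)" unfolding R2 by (simp add: algebra_simps)
      hence "res_int 0 z - poly (pCons 1 (\<Sum>i\<le>q. monom (a i) i)) w = w ^ Suc q * \<upsilon> w"
        by (simp add: poly_sum poly_monom algebra_simps)
      also have "w ^ Suc q = z ^ Suc q * res_int 0 z ^ Suc q" unfolding w by (rule power_mult_distrib)
      finally show ?case unfolding w_def[symmetric] using elim by simp
    qed
    moreover have "((\<lambda>z. res_int 0 z ^ Suc q * \<upsilon> (cauchy_recip z)) \<longlongrightarrow> 1 ^ Suc q * 0) (nt \<alpha>)"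
      by (rule tendsto_mult[OF tendsto_power[OF tendsto_res_int_0[OF \<alpha>]] l0])
    ultimately show "((\<lambda>z. (res_int 0 z - poly (pCons 1 (\<Sum>i\<le>q. monom (a i) i)) (cauchy_recip z)) / z ^ Suc q) \<longlongrightarrow> 0) (nt \<alpha>)"
      by (simp add: tendsto_cong)
  qed
qed

text \<open>Inverting \<open>w = z h(z)\<close>, \<open>h(z) = C(w) + o(z\<^sup>p)\<close> by iteration: each step gains one order.\<close>

lemma res_int_0_expansion_of_implicit:
  assumes \<alpha>: "\<alpha> > 0" and C: "\<forall>i. coeff C i \<in> \<real>" "poly C 0 = 1"
    and h: "(\<lambda>z. res_int 0 z - poly C (cauchy_recip z)) \<in> o[nt \<alpha>](\<lambda>z. z ^ p)" and n: "n \<le> p"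
  shows "\<exists>Q. (\<forall>i. coeff Q i \<in> \<real>) \<and> (\<lambda>z. res_int 0 z - poly Q z) \<in> o[nt \<alpha>](\<lambda>z. z ^ n)"
  using n
proof (induction n)
  case 0
  have "((\<lambda>z. res_int 0 z - 1) \<longlongrightarrow> 1 - 1) (nt \<alpha>)" by (intro tendsto_intros tendsto_res_int_0[OF \<alpha>])
  hence "(\<lambda>z. res_int 0 z - poly 1 z) \<in> o[nt \<alpha>](\<lambda>z. z ^ 0)" by (intro smalloI_tendsto) auto
  moreover have "\<forall>i. coeff (1 :: complex poly) i \<in> \<real>" by (auto simp: coeff_1)
  ultimately show ?case by blast
next
  case (Suc n)
  then obtain Q where Q: "\<forall>i. coeff Q i \<in> \<real>" "(\<lambda>z. res_int 0 z - poly Q z) \<in> o[nt \<alpha>](\<lambda>z. z ^ n)" by auto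
  \<comment> \<open>\<open>pCons 0 Q\<close> is z Q(z), the approximation of w obtained so far;
    inserting it into \<open>C\<close> gives the next iterate.\<close>
  let ?Q = "pcompose C (pCons 0 Q)"
  have "(\<lambda>z. poly C (cauchy_recip z) - poly ?Q z) \<in> o[nt \<alpha>](\<lambda>z. z ^ Suc n)"
    using smallo_poly_cauchy_recip[OF \<alpha> Q(2)] by (simp add: poly_pcompose)
  moreover have "(\<lambda>z. res_int 0 z - poly C (cauchy_recip z)) \<in> o[nt \<alpha>](\<lambda>z. z ^ Suc n)"
    by (rule landau_o.small_big_trans[OF h power_bigo_nt[OF Suc.prems]])
  ultimately have "(\<lambda>z. res_int 0 z - poly ?Q z) \<in> o[nt \<alpha>](\<lambda>z. z ^ Suc n)"
    by (rule smallo_diff_trans[rotated])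
  moreover have "\<forall>i. coeff ?Q i \<in> \<real>"
    by (intro Reals_coeff_pcompose C Reals_coeff_pCons Q) simp
  ultimately show ?case by blast
qed

text \<open>With \<open>n\<close> moments present, h has two expansions of order \<open>n\<close>,
  so by uniqueness \<open>Q\<close> agrees with the moment polynomial up to degree \<open>n\<close>.
  Dividing the difference by z^(n+1) expands the remainder factor, with real coefficients because
  moments are real.\<close>

lemma res_int_Suc_expansion:
  assumes \<alpha>: "\<alpha> > 0" and m: "has_moment M n" and n: "n < p" and Q: "\<forall>i. coeff Q i \<in> \<real>"
    and h: "(\<lambda>z. res_int 0 z - poly Q z) \<in> o[nt \<alpha>](\<lambda>z. z ^ p)"
  shows "\<exists>Q'. (\<forall>i. coeff Q' i \<in> \<real>) \<and> (\<lambda>z. res_int (Suc n) z - poly Q' z) \<in> o[nt \<alpha>](\<lambda>z. z ^ (p - Suc n))"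
proof -
  define N where "N = (\<Sum>i\<le>n. monom (complex_of_real (moment M i)) i)"
  have "(\<lambda>z. poly Q z - res_int 0 z) \<in> o[nt \<alpha>](\<lambda>z. z ^ n)"
    by (rule landau_o.small_big_trans[OF smallo_diff_commute[OF h] power_bigo_nt]) (use n in simp)
  from smallo_diff_trans[OF this res_int_0_moment_expansion[OF m \<alpha>]]
  have "(\<lambda>z. poly Q z - poly N z) \<in> o[nt \<alpha>](\<lambda>z. z ^ n)" by (simp only: N_def)
  moreover have "(\<lambda>z. poly Q z - poly N z) = poly (Q - N)" by (rule ext) simp
  ultimately have "poly (Q - N) \<in> o[nt \<alpha>](\<lambda>z. z ^ n)" by (simp only:)
  hence "monom 1 (Suc n) dvd Q - N"
    unfolding monom_1_dvd_iff' by (intro allI impI smallo_nt_poly_coeff_0[OF \<alpha>]) (simp_all only: less_Suc_eq_le)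
  then obtain Q' where Q': "Q - N = monom 1 (Suc n) * Q'" by (elim dvdE)
  have "coeff Q' i \<in> \<real>" for i
  proof -
    have "coeff Q' i = coeff (Q - N) (i + Suc n)" unfolding Q' by (subst coeff_monom_mult) simp
    moreover have "coeff N j \<in> \<real>" for j unfolding N_def coeff_sum by (intro sum_in_Reals) simp
    ultimately show ?thesis using Q by (simp add: Reals_diff)
  qed
  moreover have "(\<lambda>z. z ^ Suc n * (res_int (Suc n) z - poly Q' z)) \<in> o[nt \<alpha>](\<lambda>z. z ^ Suc n * z ^ (p - Suc n))"
  proof -
    have eq: "\<forall>\<^sub>F z in nt \<alpha>. res_int 0 z - poly Q z = z ^ Suc n * (res_int (Suc n) z - poly Q' z)"
      using eventually_nt_Im[OF \<alpha>]
    proof eventually_elim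
      case (elim z)
      have "poly Q z = poly N z + z ^ Suc n * poly Q' z"
        using arg_cong[OF Q', of "\<lambda>q. poly q z"] by (simp only: poly_diff poly_mult poly_monom mult_1 diff_eq_eq add.commute)
      moreover have "res_int 0 z = poly N z + z ^ Suc n * res_int (Suc n) z"
        using res_int_expand[OF m, of z] elim by (simp add: N_def poly_sum poly_monom)
      ultimately show ?case by (simp only: right_diff_distrib add_diff_cancel_left)
    qed
    moreover have "(\<lambda>z. z ^ p) = (\<lambda>z. z ^ Suc n * z ^ (p - Suc n) :: complex)"
      using n by (simp only: power_add[symmetric]) simp
    ultimately show ?thesis using h landau_o.small.in_cong[OF eq] by (simp only:)
  qed
  hence "(\<lambda>z. res_int (Suc n) z - poly Q' z) \<in> o[nt \<alpha>](\<lambda>z. z ^ (p - Suc n))"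
    by (subst (asm) landau_o.small.mult_cancel_left[OF bigtheta_refl nt_eventually_nonzero_power])
  ultimately show ?thesis by blast
qed

text \<open>One integral serves two moments: at z = -iy its real part carries t^(n+1) and its
  imaginary part -y t^(n+2), both damped by 1 + y^2 t^2.\<close>

lemma cut_moment_integral:
  assumes n: "has_moment M n"
  defines "z \<equiv> \<lambda>k. - \<i> * complex_of_real (imag_seq k)"
  shows "integrable M (cut_moment (Suc n) k)" "(\<integral>t. cut_moment (Suc n) k t \<partial>M) = Re (res_int (Suc n) (z k))"
    "integrable M (cut_moment (Suc (Suc n)) k)"
    "imag_seq k * (\<integral>t. cut_moment (Suc (Suc n)) k t \<partial>M) = - Im (res_int (Suc n) (z k))"
proof -
  have im: "Im (z k) < 0" using imag_seq(1)[of k] by (simp add: z_def)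
  note I = integrable_res_int(2)[OF n im]
  have id: "complex_of_real t ^ Suc n / (1 - z k * complex_of_real t) =
      Complex (cut_moment (Suc n) k t) (- imag_seq k * cut_moment (Suc (Suc n)) k t)" for t
  proof -
    define y where "y = imag_seq k * t"
    have c: "1 + y\<^sup>2 \<noteq> 0" by (metis add_nonneg_pos not_one_less_zero one_power2 power2_less_0 sum_power2_eq_zero_iff zero_neq_one)
    have "Complex 1 y * Complex (1 / (1 + y\<^sup>2)) (- y / (1 + y\<^sup>2)) = 1"
      using c by (simp add: complex_eq_iff power2_eq_square field_simps)
    hence "1 / Complex 1 y = Complex (1 / (1 + y\<^sup>2)) (- y / (1 + y\<^sup>2))"
      by (metis divide_eq_eq mult.commute mult_zero_left zero_neq_one)
    moreover have "1 - z k * complex_of_real t = Complex 1 y" by (simp add: complex_eq_iff z_def y_def)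
    ultimately have "complex_of_real t ^ Suc n / (1 - z k * complex_of_real t) =
        complex_of_real (t ^ Suc n) * Complex (1 / (1 + y\<^sup>2)) (- y / (1 + y\<^sup>2))"
      by (metis of_real_power times_divide_eq_right mult.right_neutral)
    also have "\<dots> = Complex (cut_moment (Suc n) k t) (- imag_seq k * cut_moment (Suc (Suc n)) k t)"
      by (simp add: complex_eq_iff cut_moment_def y_def)
    finally show ?thesis .
  qed
  have I': "integrable M (\<lambda>t. Complex (cut_moment (Suc n) k t) (- imag_seq k * cut_moment (Suc (Suc n)) k t))"
    using I unfolding id .
  have J: "res_int (Suc n) (z k) = (\<integral>t. Complex (cut_moment (Suc n) k t) (- imag_seq k * cut_moment (Suc (Suc n)) k t) \<partial>M)"
    unfolding res_int_def id ..
  show "integrable M (cut_moment (Suc n) k)" using integrable_Re[OF I'] by simp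
  show "(\<integral>t. cut_moment (Suc n) k t \<partial>M) = Re (res_int (Suc n) (z k))"
    unfolding J using integral_Re[OF I'] by simp
  have i2: "integrable M (\<lambda>t. - imag_seq k * cut_moment (Suc (Suc n)) k t)" using integrable_Im[OF I'] by simp
  thus "integrable M (cut_moment (Suc (Suc n)) k)" using imag_seq(1)[of k] by simp
  have "Im (res_int (Suc n) (z k)) = (\<integral>t. - imag_seq k * cut_moment (Suc (Suc n)) k t \<partial>M)"
    unfolding J using integral_Im[OF I'] by simp
  thus "imag_seq k * (\<integral>t. cut_moment (Suc (Suc n)) k t \<partial>M) = - Im (res_int (Suc n) (z k))" by simp
qed

text \<open>The constant term of the expansion of \<open>res_int (Suc n)\<close> is real, so its
  imaginary part is O(y) at -iy; divided by y it bounds the damped moment of order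
  \<open>n + 2\<close>. This order is even, so the integrands are nonnegative and Fatou
  applies.\<close>

lemma has_moment_even_step:
  assumes \<alpha>: "\<alpha> > 0" and m: "has_moment M n" and "even n" and n: "n + 2 \<le> p" and Q: "\<forall>i. coeff Q i \<in> \<real>"
    and h: "(\<lambda>z. res_int 0 z - poly Q z) \<in> o[nt \<alpha>](\<lambda>z. z ^ p)"
  shows "has_moment M (n + 2)"
proof -
  obtain Q' where Q': "\<forall>i. coeff Q' i \<in> \<real>"
    "(\<lambda>z. res_int (Suc n) z - poly Q' z) \<in> o[nt \<alpha>](\<lambda>z. z ^ (p - Suc n))"
    using res_int_Suc_expansion[OF \<alpha> m _ Q h] n by auto
  obtain c P where P: "Q' = pCons c P" by (rule pCons_cases)
  have c: "c \<in> \<real>" using Q'(1)[rule_format, of 0] P by simp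
  have 1: "(\<lambda>z. res_int (Suc n) z - poly Q' z) \<in> O[nt \<alpha>](\<lambda>z. z)"
    using landau_o.small_imp_big[OF landau_o.small_big_trans[OF Q'(2) power_bigo_nt[of 1]]] n by simp
  have 2: "(\<lambda>z. z * poly P z) \<in> O[nt \<alpha>](\<lambda>z. z)"
    using landau_o.big.mult[OF landau_o.big_refl bigo_1_poly[OF id_bigo_nt]] by fastforce
  have "(\<lambda>z. res_int (Suc n) z - c) \<in> O[nt \<alpha>](\<lambda>z. z)"
    using sum_in_bigo(1)[OF 1 2] by (simp add: P algebra_simps)
  then obtain B where "\<forall>\<^sub>F z in nt \<alpha>. norm (res_int (Suc n) z - c) \<le> B * norm z"
    by (elim landau_o.bigE)
  hence B: "\<forall>\<^sub>F k in sequentially. norm (res_int (Suc n) (- \<i> * complex_of_real (imag_seq k)) - c) \<le>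
      B * norm (- \<i> * complex_of_real (imag_seq k))"
    using filterlim_imag_seq[OF \<alpha>] by (rule eventually_compose_filterlim)
  note I = cut_moment_integral[OF m]
  have "integrable M (\<lambda>t. t ^ (n + 2))"
  proof (rule integrable_of_liminf_bound[where K = 0])
    show "integrable M (cut_moment (n + 2) k)" for k using I(3) by simp
    have "0 \<le> t ^ (n + 2)" for t :: real
      by (rule zero_le_even_power) (use \<open>even n\<close> in simp)
    thus "AE t in M. - 0 \<le> cut_moment (n + 2) k t" for k using cut_moment_bounds(1)[of 0] by (intro AE_I2) simp
    show "\<forall>\<^sub>F k in sequentially. (\<integral>t. cut_moment (n + 2) k t \<partial>M) \<le> B"
      using B
    proof eventually_elim
      case (elim k)
      define z where "z = - \<i> * complex_of_real (imag_seq k)"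
      have "imag_seq k * (\<integral>t. cut_moment (n + 2) k t \<partial>M) = - Im (res_int (Suc n) z - c)"
        using I(4)[of k] c by (simp add: z_def complex_is_Real_iff)
      also have "\<dots> \<le> norm (res_int (Suc n) z - c)" using abs_Im_le_cmod[of "res_int (Suc n) z - c"] by linarith
      also have "\<dots> \<le> B * norm z" using elim by (simp only: z_def)
      also have "norm z = imag_seq k" using imag_seq(1)[of k] by (simp add: z_def norm_mult)
      finally show ?case using imag_seq(1)[of k] by (simp add: mult.commute)
    qed
  qed (rule cut_moment_tendsto)
  thus ?thesis by (simp only: has_moment_integrable)
qed

text \<open>For the odd order \<open>n + 1\<close> the real part is used, which stays bounded. The
  integrand changes sign, and the bound on the support provides the one-sided estimate that Fatou
  needs.\<close>

lemma has_moment_odd_step: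
  assumes \<alpha>: "\<alpha> > 0" and m: "has_moment M n" and "even n" and Q: "\<forall>i. coeff Q i \<in> \<real>"
    and h: "(\<lambda>z. res_int 0 z - poly Q z) \<in> o[nt \<alpha>](\<lambda>z. z ^ Suc n)"
    and s: "bdd_below (measure_support M) \<or> bdd_above (measure_support M)"
  shows "has_moment M (Suc n)"
proof -
  obtain Q' where Q': "\<forall>i. coeff Q' i \<in> \<real>"
    "(\<lambda>z. res_int (Suc n) z - poly Q' z) \<in> o[nt \<alpha>](\<lambda>z. z ^ (Suc n - Suc n))"
    using res_int_Suc_expansion[OF \<alpha> m _ Q h] by auto
  have "(\<lambda>z. res_int (Suc n) z - poly Q' z) \<in> O[nt \<alpha>](\<lambda>_. 1)"
    using landau_o.small_imp_big[OF Q'(2)] by simp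
  from sum_in_bigo(1)[OF this bigo_1_poly[where P = Q', OF id_bigo_nt[of \<alpha>]]]
  have "(\<lambda>z. res_int (Suc n) z) \<in> O[nt \<alpha>](\<lambda>_. 1)" by simp
  then obtain B where "\<forall>\<^sub>F z in nt \<alpha>. norm (res_int (Suc n) z) \<le> B * norm (1 :: complex)"
    by (elim landau_o.bigE)
  hence "\<forall>\<^sub>F k in sequentially. norm (res_int (Suc n) (- \<i> * complex_of_real (imag_seq k))) \<le> B * norm (1 :: complex)"
    using filterlim_imag_seq[OF \<alpha>] by (rule eventually_compose_filterlim)
  hence B: "\<forall>\<^sub>F k in sequentially. \<bar>\<integral>t. cut_moment (Suc n) k t \<partial>M\<bar> \<le> B"
  proof eventually_elim
    case (elim k)
    thus ?case using cut_moment_integral(2)[OF m, of k] abs_Re_le_cmod order_trans by fastforce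
  qed
  note I = cut_moment_integral(1)[OF m]
  have AEs: "AE t in M. t \<in> measure_support M" by (rule AE_in_measure_support) simp
  have "integrable M (\<lambda>t. t ^ Suc n)"
    using s
  proof
    assume "bdd_below (measure_support M)"
    then obtain b where b: "\<And>t. t \<in> measure_support M \<Longrightarrow> b \<le> t" unfolding bdd_below_def by blast
    define K where "K = \<bar>b\<bar> ^ Suc n"
    have K: "- K \<le> cut_moment (Suc n) k t" if "t \<in> measure_support M" for t k
    proof (rule cut_moment_bounds(1))
      have "- \<bar>b\<bar> \<le> t" using b[OF that] by linarith
      hence "(- \<bar>b\<bar>) ^ Suc n \<le> t ^ Suc n" using \<open>even n\<close> by (intro power_mono_odd) auto
      thus "- K \<le> t ^ Suc n" using \<open>even n\<close> by (simp add: K_def)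
    qed (simp add: K_def)
    show ?thesis
    proof (rule integrable_of_liminf_bound[OF I _ cut_moment_tendsto])
      show "AE t in M. - K \<le> cut_moment (Suc n) k t" for k using AEs by eventually_elim (rule K)
      show "\<forall>\<^sub>F k in sequentially. (\<integral>t. cut_moment (Suc n) k t \<partial>M) \<le> B" using B by eventually_elim simp
    qed
  next
    assume "bdd_above (measure_support M)"
    then obtain b where b: "\<And>t. t \<in> measure_support M \<Longrightarrow> t \<le> b" unfolding bdd_above_def by blast
    define K where "K = \<bar>b\<bar> ^ Suc n"
    have K: "cut_moment (Suc n) k t \<le> K" if "t \<in> measure_support M" for t k
    proof (rule cut_moment_bounds(2))
      have "t \<le> \<bar>b\<bar>" using b[OF that] by linarith
      thus "t ^ Suc n \<le> K" unfolding K_def using \<open>even n\<close> by (intro power_mono_odd) auto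
    qed (simp add: K_def)
    \<comment> \<open>Fatou is applied to the negated integrands, which is why \<open>B\<close> was
      chosen to bound the absolute value of the integrals.\<close>
    have "integrable M (\<lambda>t. - (t ^ Suc n))"
    proof (rule integrable_of_liminf_bound[where f = "\<lambda>k t. - cut_moment (Suc n) k t"])
      show "integrable M (\<lambda>t. - cut_moment (Suc n) k t)" for k using I by simp
      show "AE t in M. - K \<le> - cut_moment (Suc n) k t" for k using AEs by eventually_elim (simp add: K)
      show "(\<lambda>k. - cut_moment (Suc n) k t) \<longlonglongrightarrow> - (t ^ Suc n)" for t by (intro tendsto_minus cut_moment_tendsto)
      show "\<forall>\<^sub>F k in sequentially. (\<integral>t. - cut_moment (Suc n) k t \<partial>M) \<le> B" using B by eventually_elim simp
    qed
    thus ?thesis by (simp del: power_Suc)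
  qed
  thus ?thesis by (simp only: has_moment_integrable)
qed

lemma R_transform_expansion_imp_moment:
  assumes R: "is_R_transform M D R" and p: "p > 0"
    and s: "even p \<or> bdd_below (measure_support M) \<or> bdd_above (measure_support M)"
    and a: "\<forall>i\<le>p - 1. a i \<in> \<real>" and T: "has_taylor_expansion D R (p - 1) a"
  shows "has_moment M p"
proof -
  define C where "C = pCons 1 (\<Sum>i\<le>p - 1. monom (a i) i)"
  \<comment> \<open>Slope 1 is an arbitrary choice: the points -iy lie in cones of every
    slope.\<close>
  have "(\<lambda>z. res_int 0 z - poly C (cauchy_recip z)) \<in> o[nt 1](\<lambda>z. z ^ p)"
    using taylor_expansion_imp_smallo[OF R T, of 1] p by (simp add: C_def)
  moreover have "\<forall>i. coeff C i \<in> \<real>"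
    unfolding C_def
  proof (rule Reals_coeff_pCons)
    show "\<forall>i. coeff (\<Sum>i\<le>p - 1. monom (a i) i) i \<in> \<real>"
      unfolding coeff_sum using a by (intro allI sum_in_Reals) simp
  qed simp
  ultimately obtain Q where Q: "\<forall>i. coeff Q i \<in> \<real>"
      "(\<lambda>z. res_int 0 z - poly Q z) \<in> o[nt 1](\<lambda>z. z ^ p)"
    using res_int_0_expansion_of_implicit[of 1 C p p] by (auto simp: C_def)
  \<comment> \<open>Even orders are reached from 0 by double steps, so a support bounded on one side
    enters only in a final step to odd \<open>p\<close>.\<close>
  have ev: "has_moment M (2 * r)" if "2 * r \<le> p" for r
    using that
  proof (induction r)
    case (Suc r)
    have "has_moment M (2 * r + 2)"
      using Suc by (intro has_moment_even_step[OF zero_less_one _ _ _ Q]) auto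
    thus ?case by simp
  qed (simp add: has_moment_0)
  show ?thesis
  proof (cases "even p")
    case True
    thus ?thesis using ev[of "p div 2"] by simp
  next
    case False
    then obtain r where r: "p = Suc (2 * r)" by (elim oddE) simp
    show ?thesis unfolding r
      using ev[of r] Q s False by (intro has_moment_odd_step[OF zero_less_one, where Q = Q]) (auto simp: r simp del: power_Suc)
  qed
qed

end

theorem theorem1p3:
  fixes p :: nat and \<mu> :: "real measure" and D :: "complex set" and R :: "complex \<Rightarrow> complex"
  assumes "p > 0"
    and "real_distribution \<mu>"
    and "is_R_transform \<mu> D R"
  shows "(has_moment \<mu> p \<longrightarrow>
            has_taylor_expansion D R (p - 1) (\<lambda>i. complex_of_real (free_cumulant \<mu> (i + 1)))) \<and>
         ((even p \<or> bdd_below (measure_support \<mu>) \<or> bdd_above (measure_support \<mu>)) \<longrightarrow>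
          (\<exists>a. (\<forall>i\<le>p - 1. a i \<in> \<real>) \<and> has_taylor_expansion D R (p - 1) a) \<longrightarrow>
          has_moment \<mu> p)"
proof (intro conjI impI)
  interpret real_distribution \<mu> by (rule assms(2))
  show "has_taylor_expansion D R (p - 1) (\<lambda>i. complex_of_real (free_cumulant \<mu> (i + 1)))"
    if "has_moment \<mu> p"
    using moment_imp_R_transform_expansion[OF assms(3,1) that] .
  show "has_moment \<mu> p"
    if "even p \<or> bdd_below (measure_support \<mu>) \<or> bdd_above (measure_support \<mu>)"
      and "\<exists>a. (\<forall>i\<le>p - 1. a i \<in> \<real>) \<and> has_taylor_expansion D R (p - 1) a"
    using R_transform_expansion_imp_moment[OF assms(3,1) that(1)] that(2) by (elim exE conjE)
qed

end
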